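(* Let $\mathbb{H}$ be a connected bipartite graph and let $k \geq 2$ be an integer. Then $\mathbb{H}$ is a bipartite absolute retract with respect to $k$-trees if and only if $\mathbb{H}$ admits a $(k+1)$-ary near-unanimity polymorphism.
   Context: Graphs are undirected (symmetric edge relation); a bipartite graph is in particular undirected. For vertices $a,b$ of a connected graph $\mathbb{H}$, $d_{\mathbb{H}}(a,b)$ is the length of a shortest path between them. A homomorphism $f:\mathbb{G}\to\mathbb{H}$ is a vertex map sending edges to edges. The product $\mathbb{H}^m$ has vertex set $H^m$, with $(a_1,\dots,a_m)$ adjacent to $(b_1,\dots,b_m)$ iff $a_ib_i$ is an edge of $\mathbb{H}$ for every $i$. A $(k+1)$-ary near-unanimity polymorphism of $\mathbb{H}$ is a homomorphism $f:\mathbb{H}^{k+1}\to\mathbb{H}$ with $f(x,\dots,x)=f(y,x,\dots,x)=f(x,y,x,\dots,x)=\dots=f(x,\dots,x,y)=x$ for all vertices $x,y$. If $\mathbb{G}$ contains $\mathbb{H}$ as an induced subgraph, $\mathbb{H}$ is a retract of $\mathbb{G}$ if there is a homomorphism $\mathbb{G}\to\mathbb{H}$ that is the identity on $H$. An $\mathbb{H}$-coloured graph is a graph $\mathbb{G}$ together with unary relations $S_h\subseteq G$ for each $h\in H$ (a vertex in $S_h$ is "coloured with $h$"; a vertex may have zero or several colours). A homomorphism of $\mathbb{H}$-coloured graphs $\mathbb{X}\to\mathbb{Y}$ is a graph homomorphism $f$ with $f(S_h(\mathbb{X}))\subseteq S_h(\mathbb{Y})$ for all $h\in H$. $\mathbb{H}^c$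 denotes $\mathbb{H}$ coloured by $S_h=\{h\}$. If $\mathbb{G}$ contains $\mathbb{H}$ as an induced subgraph, $\mathbb{G}_{\mathbb{H}}$ denotes $\mathbb{G}$ coloured by $S_h=\{h\}$ for $h\in H$ (vertices outside $H$ uncoloured). An $\mathbb{H}$-coloured graph $\mathbb{X}$ is an obstruction for an $\mathbb{H}$-coloured graph $\mathbb{Y}$ if there is no homomorphism of $\mathbb{H}$-coloured graphs $\mathbb{X}\to\mathbb{Y}$. An $\mathbb{H}$-tree is an $\mathbb{H}$-coloured graph whose underlying graph is a tree, such that the coloured vertices are exactly the leaves, each leaf has exactly one colour, and for any leaves $v_a,v_b$ coloured $a,b$ respectively, $d_{\mathbb{T}}(v_a,v_b)\equiv d_{\mathbb{H}}(a,b)\pmod 2$. $\mathbb{H}$ is a bipartite absolute retract with respect to $k$-trees if: whenever a bipartite graph $\mathbb{G}$ contains $\mathbb{H}$ as an induced subgraph and every $\mathbb{H}$-tree with at most $k$ leaves that is an obstruction for $\mathbb{H}^c$ is also an obstruction for $\mathbb{G}_{\mathbb{H}}$, then $\mathbb{H}$ is a retract of $\mathbb{G}$.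
   Formalization: Stated for finite H; it fails for infinite H (k=2: half graph a_i~b_j iff i≥j, with G adding a vertex adjacent to every b_j). The graphs G and the H-trees, which may be infinite, take their vertices in one arbitrary infinite set containing H. *)

theory Defs
  imports
    Main
    "HOL-Library.Infinite_Typeclass"
    "Graph_Theory.Digraph_Component"
begin

text \<open>
  An undirected graph is a symmetric relation on a vertex set, represented by
  \<^typ>\<open>'a pair_pre_digraph\<close> with the locale predicate \<^term>\<open>pair_sym_digraph\<close>;
  \<^const>\<open>with_proj\<close> embeds this type into the general digraphs of the library.
\<close>

definition bipartite_graph :: "'a pair_pre_digraph \<Rightarrow> bool" where
  "bipartite_graph G \<longleftrightarrow> pair_sym_digraph G \<and>
     (\<exists>A B. A \<union> B = pverts G \<and> A \<inter> B = {} \<and> parcs G \<subseteq> A \<times> B \<union> B \<times> A)"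

text \<open>Only meaningful if \<^term>\<open>u\<close> and \<^term>\<open>v\<close> are joined by a path.\<close>

definition graph_dist :: "'a pair_pre_digraph \<Rightarrow> 'a \<Rightarrow> 'a \<Rightarrow> nat" where
  "graph_dist G u v = (LEAST n. \<exists>p. pre_digraph.apath (with_proj G) u p v \<and> length p = n)"

definition graph_hom :: "'a pair_pre_digraph \<Rightarrow> 'b pair_pre_digraph \<Rightarrow> ('a \<Rightarrow> 'b) \<Rightarrow> bool" where
  "graph_hom G H f \<longleftrightarrow>
     (\<forall>v\<in>pverts G. f v \<in> pverts H) \<and> (\<forall>(u, v)\<in>parcs G. (f u, f v) \<in> parcs H)"

definition graph_power :: "'a pair_pre_digraph \<Rightarrow> nat \<Rightarrow> 'a list pair_pre_digraph" where
  "graph_power H m =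
     (let V = {xs. length xs = m \<and> set xs \<subseteq> pverts H}
      in \<lparr> pverts = V,
           parcs = {(xs, ys). xs \<in> V \<and> ys \<in> V \<and> (\<forall>i<m. (xs ! i, ys ! i) \<in> parcs H)} \<rparr>)"

definition nu_polymorphism :: "'a pair_pre_digraph \<Rightarrow> nat \<Rightarrow> ('a list \<Rightarrow> 'a) \<Rightarrow> bool" where
  "nu_polymorphism H m f \<longleftrightarrow>
     graph_hom (graph_power H m) H f \<and>
     (\<forall>x\<in>pverts H. f (replicate m x) = x) \<and>
     (\<forall>x\<in>pverts H. \<forall>y\<in>pverts H. \<forall>i<m. f ((replicate m x)[i := y]) = x)"

definition is_retract :: "'a pair_pre_digraph \<Rightarrow> 'a pair_pre_digraph \<Rightarrow> bool" where
  "is_retract H G \<longleftrightarrow> (\<exists>r. graph_hom G H r \<and> (\<forall>h\<in>pverts H. r h = h))"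

text \<open>
  The colours are the vertices of a graph \<^term>\<open>H\<close>; \<^term>\<open>colour X h\<close> is the unary
  relation $S_h$. Only its values at \<^term>\<open>h \<in> pverts H\<close> are relevant.
\<close>

record ('v, 'h) coloured_graph =
  underlying :: "'v pair_pre_digraph"
  colour :: "'h \<Rightarrow> 'v set"

definition H_coloured :: "'h pair_pre_digraph \<Rightarrow> ('v, 'h) coloured_graph \<Rightarrow> bool" where
  "H_coloured H X \<longleftrightarrow> pair_sym_digraph (underlying X) \<and>
     (\<forall>h\<in>pverts H. colour X h \<subseteq> pverts (underlying X))"

definition coloured_hom ::
  "'h pair_pre_digraph \<Rightarrow> ('v, 'h) coloured_graph \<Rightarrow> ('w, 'h) coloured_graph \<Rightarrow> ('v \<Rightarrow> 'w) \<Rightarrow> bool" where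
  "coloured_hom H X Y f \<longleftrightarrow> graph_hom (underlying X) (underlying Y) f \<and>
     (\<forall>h\<in>pverts H. f ` colour X h \<subseteq> colour Y h)"

definition obstruction ::
  "'h pair_pre_digraph \<Rightarrow> ('v, 'h) coloured_graph \<Rightarrow> ('w, 'h) coloured_graph \<Rightarrow> bool" where
  "obstruction H X Y \<longleftrightarrow> \<not> (\<exists>f. coloured_hom H X Y f)"

text \<open>
  The graph $G_H$, for a graph \<^term>\<open>G\<close> containing \<^term>\<open>H\<close>.
  For \<^term>\<open>G = H\<close> this is $H^c$.
\<close>

definition self_coloured ::
  "'a pair_pre_digraph \<Rightarrow> 'a pair_pre_digraph \<Rightarrow> ('a, 'a) coloured_graph" where
  "self_coloured H G = \<lparr> underlying = G, colour = (\<lambda>h. if h \<in> pverts H then {h} else {}) \<rparr>"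

text \<open>
  The library's predicate \<^const>\<open>tree\<close> is for digraphs: it counts $a, b, a$ as a cycle of
  length 2, which an undirected graph has at each edge. Cycles of an undirected
  loopfree graph are those of length at least 3.
\<close>

definition undirected_tree :: "'a pair_pre_digraph \<Rightarrow> bool" where
  "undirected_tree T \<longleftrightarrow> pair_bidirected_digraph T \<and>
     Digraph_Component.connected (with_proj T) \<and>
     \<not> (\<exists>p. pre_digraph.cycle (with_proj T) p \<and> 3 \<le> length p)"

definition leaves :: "'a pair_pre_digraph \<Rightarrow> 'a set" where
  "leaves T = {v \<in> pverts T. out_degree (with_proj T) v = 1}"

definition H_tree :: "'h pair_pre_digraph \<Rightarrow> ('v, 'h) coloured_graph \<Rightarrow> bool" where
  "H_tree H T \<longleftrightarrow> H_coloured H T \<and> undirected_tree (underlying T) \<and>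
     (\<Union>h\<in>pverts H. colour T h) = leaves (underlying T) \<and>
     (\<forall>v\<in>leaves (underlying T). \<exists>!h. h \<in> pverts H \<and> v \<in> colour T h) \<and>
     (\<forall>a\<in>pverts H. \<forall>b\<in>pverts H. \<forall>u\<in>colour T a. \<forall>v\<in>colour T b.
        graph_dist (underlying T) u v mod 2 = graph_dist H a b mod 2)"

text \<open>
  All graphs here have their vertices in one universe \<^typ>\<open>'a\<close>. It has to be infinite, so that
  for a finite graph \<^term>\<open>H\<close> every finite graph containing \<^term>\<open>H\<close> occurs, up to
  isomorphism, as some \<^term>\<open>G\<close>. The trees and \<^term>\<open>G\<close> may be infinite;
  if the set of leaves is infinite, then \<^const>\<open>card\<close> is 0, hence the finiteness condition.
\<close>

definition bipartite_absolute_retract :: "nat \<Rightarrow> 'a::infinite pair_pre_digraph \<Rightarrow> bool" where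
  "bipartite_absolute_retract k H \<longleftrightarrow>
     (\<forall>G :: 'a pair_pre_digraph.
        bipartite_graph G \<and> induced_subgraph (with_proj H) (with_proj G) \<and>
        (\<forall>T :: ('a, 'a) coloured_graph.
           H_tree H T \<and> finite (leaves (underlying T)) \<and> card (leaves (underlying T)) \<le> k \<and>
           obstruction H T (self_coloured H H) \<longrightarrow>
           obstruction H T (self_coloured H G)) \<longrightarrow>
        is_retract H G)"

end

theory Submission
  imports Defs "HOL-Analysis.Product_Topology"
begin

text \<open>
  From absolute retract to near-unanimity: glue the near-unanimous tuples of \<open>H\<^sup>k\<^sup>+\<^sup>1\<close> with all coordinates
  on one side of \<open>H\<close> to the vertices they are supposed to be mapped to. A retraction of the resulting
  graph onto \<open>H\<close> is a near-unanimity polymorphism. To see that it exists, cut a tree mapping to that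
  graph at the vertices mapped to \<open>H\<close>; on each piece some coordinate is compatible with the boundary.

  For the converse, by compactness \<open>G\<close> may be assumed finite. By the Baker--Pixley argument every tree of walks
  in \<open>G\<close> can be mapped to \<open>H\<close>, because those with at most \<open>k\<close> leaves can. So arc consistency gives
  nonempty lists of candidate images. Choose a retraction \<open>\<rho>\<close> of these lists, compatible with the
  arcs, whose images \<open>X g\<close> are of minimal total size. Then \<open>a \<in> X g\<close> is determined within \<open>X g\<close> by
  its neighbours in the lists \<open>X\<close>. Suppose \<open>a \<noteq> b\<close> both lie in \<open>X g\<close>, and consider the
  tree of all walks of \<open>X\<close> from \<open>(g, a)\<close>. If the walks of some large length are sent to their ends,
  then by rigidity the root is forced to be \<open>a\<close>. But any \<open>k\<close> of these
  conditions are compatible with the value \<open>b\<close> at the root: on a long segment of the tree without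
  branching, a walk of \<open>H\<close> leads from one assignment to the other, \<open>H\<close> being connected. By
  Baker--Pixley all of them are, a contradiction. Hence all \<open>X g\<close> are singletons, which gives the retraction.
\<close>

subsection \<open>Baker--Pixley\<close>

text \<open>No operation on \<open>F\<close> is named: the combined member is constrained only at
  points where all but one of the \<open>k + 1\<close> given members agree, which is what the
  extension argument works with.\<close>

definition nu_closed :: "nat \<Rightarrow> 'v set \<Rightarrow> ('v \<Rightarrow> 'a) set \<Rightarrow> bool" where
  "nu_closed k D F \<longleftrightarrow> (\<forall>fs. length fs = k + 1 \<and> set fs \<subseteq> F \<longrightarrow>
     (\<exists>f\<in>F. \<forall>v\<in>D. \<forall>c. (\<exists>i\<le>k. \<forall>j\<le>k. j \<noteq> i \<longrightarrow> (fs ! j) v = c) \<longrightarrow> f v = c))"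

text \<open>If \<open>C\<close> has more than \<open>k\<close> points, pick \<open>k + 1\<close> of
  them; by induction there is, for each picked \<open>u\<close>, a member of \<open>F\<close> that
  is right on \<open>C - {u}\<close>. At every point of \<open>C\<close> at most one of these
  members is wrong, so their combination is right everywhere.\<close>

lemma nu_closed_extend:
  assumes F: "nu_closed k D F" and "finite C" "C \<subseteq> D"
    and sub: "\<And>C'. C' \<subseteq> C \<Longrightarrow> card C' \<le> k \<Longrightarrow> \<exists>f\<in>F. \<forall>v\<in>C'. f v = c v"
  shows "\<exists>f\<in>F. \<forall>v\<in>C. f v = c v"
  using assms(2-)
proof (induction "card C" arbitrary: C rule: less_induct)
  case less
  show ?case
  proof (cases "card C \<le> k")
    case True
    then show ?thesis using less.prems by blast
  next
    case False
    then obtain B where B: "B \<subseteq> C" "card B = k + 1"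
      by (metis Suc_eq_plus1 not_less_eq_eq obtain_subset_with_card_n)
    then have "finite B" by (metis less.prems(1) finite_subset)
    then obtain vs where vs: "set vs = B" "distinct vs"
      by (metis finite_distinct_list)
    then have len: "length vs = k + 1" using B by (metis distinct_card)
    have "\<exists>f\<in>F. \<forall>v\<in>C - {u}. f v = c v" if "u \<in> B" for u
    proof (rule less.hyps)
      show "card (C - {u}) < card C"
        using that B less.prems(1) by (meson card_Diff1_less subsetD)
      show "\<exists>f\<in>F. \<forall>v\<in>C'. f v = c v" if "C' \<subseteq> C - {u}" "card C' \<le> k" for C'
        using that less.prems(3)[of C'] by blast
    qed (use less.prems in auto)
    then obtain g where g: "\<And>u. u \<in> B \<Longrightarrow> g u \<in> F \<and> (\<forall>v\<in>C - {u}. g u v = c v)" by metis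
    have "length (map g vs) = k + 1" "set (map g vs) \<subseteq> F" using g vs len by auto
    then obtain f where f: "f \<in> F"
      and nu: "\<forall>v\<in>D. \<forall>a. (\<exists>i\<le>k. \<forall>j\<le>k. j \<noteq> i \<longrightarrow> (map g vs ! j) v = a) \<longrightarrow> f v = a"
      using F unfolding nu_closed_def by blast
    have "f v = c v" if v: "v \<in> C" for v
    proof -
      \<comment> \<open>\<open>vs\<close> is distinct, so \<open>v\<close> occurs in it at most
        once; if it does not occur, any index serves as \<open>i\<close>.\<close>
      have "\<exists>i\<le>k. \<forall>j\<le>k. j \<noteq> i \<longrightarrow> vs ! j \<noteq> v"
        using vs len by (metis Suc_eq_plus1 le0 less_Suc_eq_le nth_eq_iff_index_eq)
      then obtain i where i: "i \<le> k" "\<And>j. j \<le> k \<Longrightarrow> j \<noteq> i \<Longrightarrow> vs ! j \<noteq> v" by blast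
      have "(map g vs ! j) v = c v" if "j \<le> k" "j \<noteq> i" for j
      proof -
        have "vs ! j \<in> B" using that len vs by (metis Suc_eq_plus1 le_imp_less_Suc nth_mem)
        then show ?thesis using g[of "vs ! j"] i that v len by auto
      qed
      then show ?thesis using nu i(1) v less.prems by blast
    qed
    then show ?thesis using f by blast
  qed
qed

subsection \<open>Walks\<close>

text \<open>The start is not stored in the list. So the walks from \<open>x\<close> are a
  prefix-closed set of lists with root \<open>[]\<close>, the children of \<open>w\<close> are the
  walks \<open>w @ [y]\<close>, and the current vertex is \<open>last (x # w)\<close>.\<close>

primrec walk :: "('x \<times> 'x) set \<Rightarrow> 'x \<Rightarrow> 'x list \<Rightarrow> bool" where
  "walk R x [] \<longleftrightarrow> True"
| "walk R x (y # w) \<longleftrightarrow> (x, y) \<in> R \<and> walk R y w"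

lemma walk_append: "walk R x (u @ w) \<longleftrightarrow> walk R x u \<and> walk R (last (x # u)) w"
  by (induction u arbitrary: x) auto

lemma finite_walks:
  assumes "finite V" "R \<subseteq> V \<times> V"
  shows "finite {w. walk R x w \<and> length w \<le> n}"
proof (rule finite_subset)
  have "walk R x w \<Longrightarrow> set w \<subseteq> V" for w
    using assms(2) by (induction w arbitrary: x) auto
  then show "{w. walk R x w \<and> length w \<le> n} \<subseteq> {w. set w \<subseteq> V \<and> length w \<le> n}" by blast
qed (rule finite_lists_length_le[OF assms(1)])

lemma walk_induct_rev [consumes 1, case_names Nil snoc]:
  assumes "walk R x w" "P []"
    and "\<And>w y. walk R x w \<Longrightarrow> (last (x # w), y) \<in> R \<Longrightarrow> P w \<Longrightarrow> P (w @ [y])"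
  shows "P w"
  using assms(1)
  by (induction w rule: rev_induct) (auto intro: assms simp: walk_append)

lemma relpow_parity:
  fixes side :: "'a \<Rightarrow> bool"
  assumes "\<And>a b. (a, b) \<in> E \<Longrightarrow> side a \<noteq> side b" "(a, b) \<in> E ^^ n"
  shows "side a = side b \<longleftrightarrow> even n"
  using assms(2) by (induction n arbitrary: b) (auto dest: assms(1))

text \<open>Going back and forth along an arc lengthens a walk by two, and the sides fix the parity
  of its length. The maximum over the finitely many pairs gives a common bound.\<close>

lemma uniform_walk_length:
  fixes side :: "'a \<Rightarrow> bool"
  assumes "finite V" and sym: "\<And>a b. (a, b) \<in> E \<Longrightarrow> (b, a) \<in> E"
    and side: "\<And>a b. (a, b) \<in> E \<Longrightarrow> side a \<noteq> side b"
    and conn: "\<And>a b. a \<in> V \<Longrightarrow> b \<in> V \<Longrightarrow> (a, b) \<in> E\<^sup>*" and "(c, d) \<in> E" "c \<in> V"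
  shows "\<exists>\<delta>. \<forall>n\<ge>\<delta>. \<forall>a\<in>V. \<forall>b\<in>V. (side a = side b \<longleftrightarrow> even n) \<longrightarrow> (a, b) \<in> E ^^ n"
proof -
  have "\<exists>n. (a, b) \<in> E ^^ n" if "a \<in> V" "b \<in> V" for a b
    using conn[OF that] by (simp add: rtrancl_is_UN_relpow)
  then obtain N where N: "\<And>a b. a \<in> V \<Longrightarrow> b \<in> V \<Longrightarrow> (a, b) \<in> E ^^ N a b" by metis
  have ext: "(a, b) \<in> E ^^ (N a b + 2 * i)" if ab: "a \<in> V" "b \<in> V" for a b i
  proof (induction i)
    case (Suc i)
    \<comment> \<open>Whether or not \<open>b\<close> equals \<open>c\<close>, the walk to
      \<open>c\<close> followed by the arc at \<open>c\<close> starts with an arc at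
      \<open>b\<close>.\<close>
    have "(b, c) \<in> E\<^sup>*" using conn ab assms by blast
    then obtain z where "(b, z) \<in> E" using \<open>(c, d) \<in> E\<close> by (metis converse_rtranclE)
    then have "(a, b) \<in> E ^^ Suc (Suc (N a b + 2 * i))" using Suc sym by auto
    then show ?case by (simp only: mult_Suc_right add_2_eq_Suc add_Suc_right)
  qed (use N ab in simp)
  define \<delta> where "\<delta> = Max ((\<lambda>(a, b). N a b) ` (V \<times> V))"
  have le: "N a b \<le> \<delta>" if "a \<in> V" "b \<in> V" for a b
    unfolding \<delta>_def using that assms(1) by (intro Max_ge) auto
  have "(a, b) \<in> E ^^ n" if n: "\<delta> \<le> n" and ab: "a \<in> V" "b \<in> V" "side a = side b \<longleftrightarrow> even n" for n a b
  proof -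
    have "even (N a b) \<longleftrightarrow> even n" using relpow_parity[of E side, OF side N[OF ab(1,2)]] ab(3) by simp
    then have "even (n - N a b)" using le[OF ab(1,2)] n by simp
    then obtain i where "n - N a b = 2 * i" by blast
    then have "n = N a b + 2 * i" using le[OF ab(1,2)] n by simp
    then show ?thesis using ext[OF ab(1,2)] by simp
  qed
  then show ?thesis by blast
qed

section \<open>Homomorphisms from trees of walks to \<open>H\<close>\<close>

locale bipartite_target =
  fixes VH :: "'a set" and E :: "('a \<times> 'a) set" and side :: "'a \<Rightarrow> bool" and \<delta> :: nat
  assumes finite_VH: "finite VH"
    and E_VH: "(a, b) \<in> E \<Longrightarrow> a \<in> VH \<and> b \<in> VH"
    and E_sym: "(a, b) \<in> E \<Longrightarrow> (b, a) \<in> E"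
    and E_side: "(a, b) \<in> E \<Longrightarrow> side a \<noteq> side b"
    and E_walk: "\<lbrakk>\<delta> \<le> n; a \<in> VH; b \<in> VH; side a = side b \<longleftrightarrow> even n\<rbrakk> \<Longrightarrow> (a, b) \<in> E ^^ n"
begin

text \<open>A closed walk of positive even length starts with an arc. So \<open>E_walk\<close>
  expresses, besides connectedness, that no vertex is isolated.\<close>

lemma ex_neighbour: "a \<in> VH \<Longrightarrow> \<exists>b. (a, b) \<in> E"
proof -
  assume "a \<in> VH"
  then have "(a, a) \<in> E ^^ (Suc (Suc (2 * \<delta>)))" by (intro E_walk) auto
  then show ?thesis by (meson relpow_Suc_D2)
qed

definition nbr :: "'a \<Rightarrow> 'a" where "nbr a = (SOME b. (a, b) \<in> E)"

lemma nbr: "a \<in> VH \<Longrightarrow> (a, nbr a) \<in> E"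
  unfolding nbr_def using ex_neighbour by (rule someI_ex)

text \<open>
  The walks from \<open>x\<close>, ordered by prefix, form a tree; values at lists that are not walks are irrelevant.
\<close>

definition treehom :: "('x \<times> 'x) set \<Rightarrow> ('x \<Rightarrow> 'a) \<Rightarrow> 'x \<Rightarrow> ('x list \<Rightarrow> 'a) set" where
  "treehom R lab x = {f. \<forall>w. walk R x w \<longrightarrow> f w \<in> VH \<and> side (f w) = side (lab (last (x # w))) \<and>
     (\<forall>y. (last (x # w), y) \<in> R \<longrightarrow> (f w, f (w @ [y])) \<in> E)}"

lemma treehomD:
  assumes "f \<in> treehom R lab x" "walk R x w"
  shows "f w \<in> VH" "side (f w) = side (lab (last (x # w)))"
    and "(last (x # w), y) \<in> R \<Longrightarrow> (f w, f (w @ [y])) \<in> E"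
  using assms unfolding treehom_def by blast+

text \<open>Once the root is right, arcs carry both membership in \<open>VH\<close> and the side
  down the tree, because \<open>lab\<close> and \<open>E\<close> change sides in step.\<close>

lemma treehomI:
  assumes side: "\<And>x y. (x, y) \<in> R \<Longrightarrow> side (lab x) \<noteq> side (lab y)"
    and "f [] \<in> VH" "side (f []) = side (lab x)"
    and "\<And>w y. walk R x w \<Longrightarrow> f w \<in> VH \<Longrightarrow> (last (x # w), y) \<in> R \<Longrightarrow> (f w, f (w @ [y])) \<in> E"
  shows "f \<in> treehom R lab x"
proof -
  have "f w \<in> VH \<and> side (f w) = side (lab (last (x # w)))" if "walk R x w" for w
    using that
  proof (induction rule: walk_induct_rev)
    case Nil
    then show ?case using assms by simp
  next
    case (snoc w y)
    then have "(f w, f (w @ [y])) \<in> E" using assms by blast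
    then show ?case using snoc side[of "last (x # w)" y] E_VH E_side by auto
  qed
  then show ?thesis using assms unfolding treehom_def by blast
qed

text \<open>The tree at \<open>x\<close> is a root with the trees at its successors hung below it;
  the inductions that descend the tree build their homomorphisms this way.\<close>

lemma treehom_glue:
  assumes "b \<in> VH" "side b = side (lab x)"
    and g: "\<And>y. (x, y) \<in> R \<Longrightarrow> g y \<in> treehom R lab y \<and> (b, g y []) \<in> E"
  shows "(\<lambda>w. case w of [] \<Rightarrow> b | y # w' \<Rightarrow> g y w') \<in> treehom R lab x"
  unfolding treehom_def
proof (intro CollectI allI impI)
  fix w assume w: "walk R x w"
  let ?f = "\<lambda>w. case w of [] \<Rightarrow> b | y # w' \<Rightarrow> g y w'"
  show "?f w \<in> VH \<and> side (?f w) = side (lab (last (x # w))) \<and>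
     (\<forall>y. (last (x # w), y) \<in> R \<longrightarrow> (?f w, ?f (w @ [y])) \<in> E)"
  proof (cases w)
    case Nil
    then show ?thesis using assms by auto
  next
    case (Cons z w')
    then have "g z \<in> treehom R lab z" "walk R z w'" using w g by auto
    from treehomD[OF this] show ?thesis using Cons by auto
  qed
qed

text \<open>Outside the prefix-closed set \<open>P\<close> the homomorphism continues by arbitrary
  neighbours, which exist everywhere.\<close>

lemma treehom_extend:
  assumes side: "\<And>x y. (x, y) \<in> R \<Longrightarrow> side (lab x) \<noteq> side (lab y)"
    and root: "[] \<in> P" "f0 [] \<in> VH" "side (f0 []) = side (lab x)"
    and P: "\<And>w y. w @ [y] \<in> P \<Longrightarrow> w \<in> P"
    and f0: "\<And>w y. w @ [y] \<in> P \<Longrightarrow> (f0 w, f0 (w @ [y])) \<in> E"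
  shows "\<exists>f\<in>treehom R lab x. \<forall>w\<in>P. f w = f0 w"
proof -
  \<comment> \<open>The recursion runs over the reversed word, since children are formed at the end
    of a list; \<open>c\<close> is the value at the parent.\<close>
  define g where "g = rec_list (f0 []) (\<lambda>y r c. if rev (y # r) \<in> P then f0 (rev (y # r)) else nbr c)"
  define f where "f = (\<lambda>w. g (rev w))"
  have f_nil: "f [] = f0 []" unfolding f_def g_def by simp
  have f_snoc: "f (w @ [y]) = (if w @ [y] \<in> P then f0 (w @ [y]) else nbr (f w))" for w y
    unfolding f_def g_def by simp
  have eq: "f w = f0 w" if "w \<in> P" for w
    using that by (cases w rule: rev_cases) (auto simp: f_nil f_snoc)
  have "f \<in> treehom R lab x"
  proof (rule treehomI[OF side])
    show "(f w, f (w @ [y])) \<in> E" if "f w \<in> VH" for w y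
      using that P[of w y] f0 nbr[OF that] by (auto simp: f_snoc eq)
  qed (use root f_nil in auto)
  then show ?thesis using eq by blast
qed

lemma treehom_exists:
  assumes "\<And>x y. (x, y) \<in> R \<Longrightarrow> side (lab x) \<noteq> side (lab y)" "b \<in> VH" "side b = side (lab x)"
  shows "\<exists>f\<in>treehom R lab x. f [] = b"
  using treehom_extend[of R lab "{[]}" "\<lambda>_. b" x] assms by auto

end

section \<open>Near-unanimity acting on tree homomorphisms\<close>

locale nu_target = bipartite_target +
  fixes m :: "'a list \<Rightarrow> 'a" and k :: nat
  assumes m_hom: "\<lbrakk>length xs = k + 1; length ys = k + 1; \<And>i. i \<le> k \<Longrightarrow> (xs ! i, ys ! i) \<in> E\<rbrakk>
      \<Longrightarrow> (m xs, m ys) \<in> E"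
    and m_nu: "\<lbrakk>length xs = k + 1; set xs \<subseteq> VH; c \<in> VH; i \<le> k; \<And>j. j \<le> k \<Longrightarrow> j \<noteq> i \<Longrightarrow> xs ! j = c\<rbrakk>
      \<Longrightarrow> m xs = c"
    and k_ge: "2 \<le> k"
begin

lemma m_walk:
  assumes "length xs = k + 1" "length ys = k + 1" "\<And>i. i \<le> k \<Longrightarrow> (xs ! i, ys ! i) \<in> E ^^ n"
  shows "(m xs, m ys) \<in> E ^^ n"
  using assms
proof (induction n arbitrary: ys)
  case 0
  then have "xs = ys" by (intro nth_equalityI) auto
  then show ?case by simp
next
  case (Suc n)
  then have "\<forall>i\<le>k. \<exists>z. (xs ! i, z) \<in> E ^^ n \<and> (z, ys ! i) \<in> E" by auto
  then obtain z where z: "\<And>i. i \<le> k \<Longrightarrow> (xs ! i, z i) \<in> E ^^ n \<and> (z i, ys ! i) \<in> E" by metis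
  define zs where "zs = map z [0..<k + 1]"
  have zs: "length zs = k + 1" "\<And>i. i \<le> k \<Longrightarrow> zs ! i = z i"
    unfolding zs_def by (auto simp del: upt_Suc)
  have "(m xs, m zs) \<in> E ^^ n" using Suc zs z by simp
  moreover have "(m zs, m ys) \<in> E" using Suc zs z by (intro m_hom) auto
  ultimately show ?case by auto
qed

lemma relpow_side: "(a, b) \<in> E ^^ n \<Longrightarrow> side a = side b \<longleftrightarrow> even n"
  using relpow_parity[of E side] E_side by blast

text \<open>All coordinates reach \<open>?c\<close> by walks of one common even length, and
  \<open>m\<close> combines these into a walk from \<open>m xs\<close> to \<open>?c\<close>. Its
  length is positive, so \<open>m xs\<close> is a vertex, and even, so the side is kept.\<close>

lemma m_pure:
  assumes "length xs = k + 1" "set xs \<subseteq> VH" "\<And>x. x \<in> set xs \<Longrightarrow> side x = s"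
  shows "m xs \<in> VH" "side (m xs) = s"
proof -
  let ?n = "Suc (2 * \<delta> + 1)" and ?c = "hd xs"
  have c: "?c \<in> set xs" using assms(1) by (cases xs) auto
  have "(m xs, m (replicate (k + 1) ?c)) \<in> E ^^ ?n"
  proof (rule m_walk)
    fix i assume "i \<le> k"
    then have "xs ! i \<in> set xs" using assms(1) by simp
    then show "(xs ! i, replicate (k + 1) ?c ! i) \<in> E ^^ ?n"
      using assms c \<open>i \<le> k\<close> by (intro E_walk) (auto simp del: replicate.simps)
  qed (use assms in auto)
  moreover have "m (replicate (k + 1) ?c) = ?c"
    using c assms by (intro m_nu[where i = 0]) (auto simp del: replicate.simps)
  ultimately have "(m xs, ?c) \<in> E ^^ ?n" by simp
  then show "m xs \<in> VH" "side (m xs) = s"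
    using relpow_Suc_D2[of "m xs" ?c "2 * \<delta> + 1" E] E_VH relpow_side[of "m xs" ?c ?n] assms c by auto
qed

text \<open>The operation \<open>m\<close> is applied pointwise. Members of \<open>treehom\<close>
  have the side prescribed by \<open>lab\<close>, so at each walk \<open>m\<close> meets a tuple
  from one side, as \<open>m_pure\<close> requires.\<close>

lemma treehom_nu_closed: "nu_closed k {w. walk R x w} (treehom R lab x)"
  unfolding nu_closed_def
proof (intro allI impI)
  fix fs assume fs: "length fs = k + 1 \<and> set fs \<subseteq> treehom R lab x"
  define f where "f = (\<lambda>w. m (map (\<lambda>g. g w) fs))"
  have nth: "fs ! i \<in> treehom R lab x" if "i \<le> k" for i using fs that by auto
  have mem: "g \<in> treehom R lab x" if "g \<in> set fs" for g using fs that by auto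
  have "f \<in> treehom R lab x"
    unfolding treehom_def
  proof (intro CollectI allI impI)
    fix w assume w: "walk R x w"
    have "length (map (\<lambda>g. g w) fs) = k + 1" "set (map (\<lambda>g. g w) fs) \<subseteq> VH"
      and "\<And>a. a \<in> set (map (\<lambda>g. g w) fs) \<Longrightarrow> side a = side (lab (last (x # w)))"
      using fs treehomD(1,2)[OF mem w] by fastforce+
    from m_pure[OF this] have "f w \<in> VH" "side (f w) = side (lab (last (x # w)))"
      unfolding f_def by blast+
    moreover have "(f w, f (w @ [y])) \<in> E" if "(last (x # w), y) \<in> R" for y
      unfolding f_def using fs treehomD(3)[OF nth w that] by (intro m_hom) auto
    ultimately show "f w \<in> VH \<and> side (f w) = side (lab (last (x # w))) \<and>
      (\<forall>y. (last (x # w), y) \<in> R \<longrightarrow> (f w, f (w @ [y])) \<in> E)" by blast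
  qed
  moreover have "f w = c" if w: "walk R x w" and c: "\<exists>i\<le>k. \<forall>j\<le>k. j \<noteq> i \<longrightarrow> (fs ! j) w = c" for w c
  proof -
    obtain i where i: "i \<le> k" "\<And>j. j \<le> k \<Longrightarrow> j \<noteq> i \<Longrightarrow> (fs ! j) w = c" using c by blast
    \<comment> \<open>In \<open>nu_closed\<close> the value \<open>c\<close> is arbitrary; a
      coordinate other than \<open>i\<close> attains it and thereby shows that it is a
      vertex.\<close>
    have "\<exists>j\<le>k. j \<noteq> i" using k_ge by (metis le0 le_trans one_le_numeral zero_neq_one)
    then have "c \<in> VH" using i treehomD(1)[OF nth w] by blast
    then show ?thesis unfolding f_def using fs i treehomD(1)[OF mem w]
      by (intro m_nu[of _ c i]) auto
  qed
  ultimately show "\<exists>f\<in>treehom R lab x. \<forall>w\<in>{w. walk R x w}. \<forall>c.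
      (\<exists>i\<le>k. \<forall>j\<le>k. j \<noteq> i \<longrightarrow> (fs ! j) w = c) \<longrightarrow> f w = c" by blast
qed

end

text \<open>\<open>VG\<close> with \<open>EG\<close> plays the finite part of the larger graph,
  containing all vertices of \<open>H\<close>, to which compactness reduces the problem.\<close>

locale nu_extension = nu_target +
  fixes VG :: "'a set" and EG :: "('a \<times> 'a) set"
  assumes finite_VG: "finite VG"
    and EG_VG: "EG \<subseteq> VG \<times> VG"
    and EG_sym: "(u, v) \<in> EG \<Longrightarrow> (v, u) \<in> EG"
    and EG_side: "(u, v) \<in> EG \<Longrightarrow> side u \<noteq> side v"
    and VH_VG: "VH \<subseteq> VG"
    and EG_E: "\<lbrakk>u \<in> VH; v \<in> VH; (u, v) \<in> EG\<rbrakk> \<Longrightarrow> (u, v) \<in> E"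
begin

subsection \<open>Arc consistency\<close>

text \<open>The candidates that survive \<open>n\<close> rounds of arc consistency. A vertex of
  \<open>H\<close> keeps itself in every round; compatibility at its arcs is enforced from the other
  end.\<close>

primrec lev :: "nat \<Rightarrow> 'a \<Rightarrow> 'a set" where
  "lev 0 g = (if g \<in> VH then {g} else {a \<in> VH. side a = side g})"
| "lev (Suc n) g = (if g \<in> VH then {g} else
     {a \<in> lev n g. \<forall>g'. (g, g') \<in> EG \<longrightarrow> (\<exists>c\<in>lev n g'. (a, c) \<in> E)})"

lemma lev_VH: "h \<in> VH \<Longrightarrow> lev n h = {h}"
  by (cases n) auto

lemma lev_subset: "lev n g \<subseteq> {a \<in> VH. side a = side g}"
  by (induction n) auto

text \<open>One round of arc consistency looks one arc further, so a homomorphism that is right at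
  all short walks into \<open>H\<close> shows that its own values survive; the values at the
  children are the witnesses. It is applied to \<open>stop_arcs\<close> with \<open>id\<close> and
  to \<open>list_arcs\<close> with \<open>fst\<close>.\<close>

lemma lev_of_solution:
  assumes f: "f \<in> treehom R lab x"
    and lift: "\<And>y g'. y \<in> Y \<Longrightarrow> lab y \<notin> VH \<Longrightarrow> (lab y, g') \<in> EG \<Longrightarrow> \<exists>y'. (y, y') \<in> R \<and> lab y' = g'"
    and Y: "x \<in> Y" "\<And>y y'. (y, y') \<in> R \<Longrightarrow> y' \<in> Y"
    and col: "\<And>w. walk R x w \<Longrightarrow> length w \<le> N \<Longrightarrow> lab (last (x # w)) \<in> VH \<Longrightarrow> f w = lab (last (x # w))"
    and w: "walk R x w" "length w + n \<le> N"
  shows "f w \<in> lev n (lab (last (x # w)))"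
  using w
proof (induction n arbitrary: w)
  case 0
  then show ?case using col[of w] treehomD[OF f, of w] by auto
next
  case (Suc n)
  let ?y = "last (x # w)"
  show ?case
  proof (cases "lab ?y \<in> VH")
    case True
    then show ?thesis using col[of w] Suc by simp
  next
    case False
    have yY: "?y \<in> Y"
      using Suc.prems(1) Y by (induction rule: walk_induct_rev) auto
    have "\<exists>c\<in>lev n g'. (f w, c) \<in> E" if g': "(lab ?y, g') \<in> EG" for g'
    proof -
      obtain y' where y': "(?y, y') \<in> R" "lab y' = g'" using lift[OF yY False g'] by blast
      have "walk R x (w @ [y'])" using Suc.prems y' by (simp add: walk_append)
      then have "f (w @ [y']) \<in> lev n g'" using Suc.IH[of "w @ [y']"] Suc.prems y' by simp
      then show ?thesis using treehomD(3)[OF f Suc.prems(1) y'(1)] by blast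
    qed
    then show ?thesis using False Suc.IH[of w] Suc.prems by simp
  qed
qed

text \<open>Walks along these arcs stop at \<open>H\<close>, which makes the coloured vertices leaves of their tree.\<close>

definition stop_arcs :: "('a \<times> 'a) set" where
  "stop_arcs = {(u, v) \<in> EG. u \<notin> VH}"

lemma stop_arcs_side: "(u, v) \<in> stop_arcs \<Longrightarrow> side (id u) \<noteq> side (id v)"
  unfolding stop_arcs_def using EG_side by auto

text \<open>By Baker--Pixley the finitely many walks of length at most \<open>n\<close> into
  \<open>H\<close> can be prescribed all at once, as any \<open>k\<close> of them can. The value at
  the root is then a surviving candidate.\<close>

lemma lev_nonempty:
  assumes few: "\<And>W. finite W \<Longrightarrow> card W \<le> k \<Longrightarrow> \<forall>w\<in>W. walk stop_arcs g w \<and> last (g # w) \<in> VH \<Longrightarrow>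
      \<exists>f\<in>treehom stop_arcs id g. \<forall>w\<in>W. f w = last (g # w)"
  shows "lev n g \<noteq> {}"
proof -
  define C where "C = {w. walk stop_arcs g w \<and> length w \<le> n \<and> last (g # w) \<in> VH}"
  have "stop_arcs \<subseteq> VG \<times> VG" using EG_VG unfolding stop_arcs_def by auto
  from finite_walks[OF finite_VG this] have fin: "finite C"
    unfolding C_def by (rule rev_finite_subset) auto
  have "\<exists>f\<in>treehom stop_arcs id g. \<forall>w\<in>C. f w = last (g # w)"
  proof (rule nu_closed_extend[OF treehom_nu_closed fin])
    show "\<exists>f\<in>treehom stop_arcs id g. \<forall>w\<in>C'. f w = last (g # w)" if "C' \<subseteq> C" "card C' \<le> k" for C'
      using that fin by (intro few) (auto simp: C_def dest: finite_subset)
  qed (auto simp: C_def)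
  then obtain f where f: "f \<in> treehom stop_arcs id g" "\<forall>w\<in>C. f w = last (g # w)" by blast
  have "f [] \<in> lev n (id (last (g # [])))"
    by (rule lev_of_solution[OF f(1), of UNIV n]) (use f(2) in \<open>auto simp: C_def stop_arcs_def\<close>)
  then show ?thesis by auto
qed

lemma lev_stabilises: "\<exists>n. \<forall>g\<in>VG. lev (Suc n) g = lev n g"
proof -
  define s where "s n = (\<Sum>g\<in>VG. card (lev n g))" for n
  obtain n where n: "\<forall>i. s n \<le> s i" using ex_has_least_nat[of "\<lambda>_. True" 0 s] by auto
  have fin: "finite (lev i g)" for i g
    using lev_subset[of i g] finite_VH by (auto intro: finite_subset)
  have sub: "lev (Suc n) g \<subseteq> lev n g" for g by (auto simp: lev_VH)
  have "lev (Suc n) g = lev n g" if "g \<in> VG" for g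
  proof (rule card_subset_eq[OF fin sub])
    have le: "card (lev (Suc n) i) \<le> card (lev n i)" for i by (rule card_mono[OF fin sub])
    then have "s (Suc n) = s n" using n unfolding s_def by (meson le_antisym sum_mono)
    then show "card (lev (Suc n) g) = card (lev n g)"
      using sum_mono_inv[of "\<lambda>g. card (lev (Suc n) g)" VG "\<lambda>g. card (lev n g)" g] le that finite_VG
      unfolding s_def by blast
  qed
  then show ?thesis by blast
qed

section \<open>Consistent lists and prescribed ends of long walks\<close>

definition consistent :: "('a \<Rightarrow> 'a set) \<Rightarrow> bool" where
  "consistent X \<longleftrightarrow> (\<forall>g. X g \<subseteq> {a \<in> VH. side a = side g}) \<and> (\<forall>h\<in>VH. X h = {h}) \<and>
     (\<forall>u v. (u, v) \<in> EG \<longrightarrow> (\<forall>a\<in>X u. \<exists>c\<in>X v. (a, c) \<in> E))"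

text \<open>The subgraph of the product of the larger graph with \<open>H\<close> induced on the
  pairs \<open>(g, a)\<close> with \<open>a\<close> in \<open>X g\<close>; \<open>fst\<close> and
  \<open>snd\<close> are homomorphisms.\<close>

definition list_arcs :: "('a \<Rightarrow> 'a set) \<Rightarrow> (('a \<times> 'a) \<times> ('a \<times> 'a)) set" where
  "list_arcs X = {((u, a), (v, c)). (u, v) \<in> EG \<and> a \<in> X u \<and> c \<in> X v \<and> (a, c) \<in> E}"

lemma list_arcsD:
  assumes "(x, y) \<in> list_arcs X"
  shows "(fst x, fst y) \<in> EG" "snd x \<in> X (fst x)" "snd y \<in> X (fst y)" "(snd x, snd y) \<in> E"
  using assms unfolding list_arcs_def by auto

lemma list_arcs_side: "(x, y) \<in> list_arcs X \<Longrightarrow> side (fst x) \<noteq> side (fst y)"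
  using list_arcsD EG_side by blast

context
  fixes X assumes X: "consistent X"
begin

lemma XD:
  shows "a \<in> X g \<Longrightarrow> a \<in> VH" "a \<in> X g \<Longrightarrow> side a = side g"
    "h \<in> VH \<Longrightarrow> X h = {h}" "(u, v) \<in> EG \<Longrightarrow> a \<in> X u \<Longrightarrow> \<exists>c\<in>X v. (a, c) \<in> E"
  using X unfolding consistent_def by blast+

lemma list_walk_end: "walk (list_arcs X) x w \<Longrightarrow> snd x \<in> X (fst x) \<Longrightarrow>
    snd (last (x # w)) \<in> X (fst (last (x # w)))"
  by (induction rule: walk_induct_rev) (auto dest: list_arcsD)

lemma list_walk_relpow: "walk (list_arcs X) x w \<Longrightarrow> (snd x, snd (last (x # w))) \<in> E ^^ length w"
  by (induction rule: walk_induct_rev) (auto dest: list_arcsD)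

lemma projection_treehom:
  assumes "snd x \<in> X (fst x)"
  shows "(\<lambda>w. snd (last (x # w))) \<in> treehom (list_arcs X) fst x"
  by (rule treehomI[OF list_arcs_side]) (use assms XD in \<open>auto dest: list_arcsD\<close>)

lemma list_treehom_exists:
  "b \<in> VH \<Longrightarrow> side b = side (fst x) \<Longrightarrow> \<exists>f\<in>treehom (list_arcs X) fst x. f [] = b"
  by (rule treehom_exists[OF list_arcs_side])

text \<open>Along the spine \<open>p\<close> the values follow a walk of \<open>H\<close> of the
  same length from \<open>b\<close> to the second component of the end of \<open>p\<close>; below
  that end they follow the projection \<open>snd\<close>, and on the side branches they are
  arbitrary.\<close>

lemma transit:
  assumes "walk (list_arcs X) x p" "(b, snd (last (x # p))) \<in> E ^^ length p"
    and "b \<in> VH" "side b = side (fst x)" "snd x \<in> X (fst x)"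
  shows "\<exists>f\<in>treehom (list_arcs X) fst x. f [] = b \<and> (\<forall>w. f (p @ w) = snd (last (x # p @ w)))"
  using assms
proof (induction p arbitrary: x b)
  case Nil
  then show ?case by (intro bexI[OF _ projection_treehom]) auto
next
  case (Cons y p)
  then obtain b' where b': "(b, b') \<in> E" "(b', snd (last (y # p))) \<in> E ^^ length p"
    using relpow_Suc_D2[of b "snd (last (x # y # p))" "length p" E] by auto
  have y: "(x, y) \<in> list_arcs X" using Cons by simp
  have sb: "b' \<in> VH" "side b' \<noteq> side (fst x)" using b' Cons E_VH E_side by blast+
  then have "\<exists>f\<in>treehom (list_arcs X) fst y. f [] = b' \<and> (\<forall>w. f (p @ w) = snd (last (y # p @ w)))"
    using Cons.prems b' list_arcs_side[OF y] by (intro Cons.IH) (auto dest: list_arcsD)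
  then obtain f where f: "f \<in> treehom (list_arcs X) fst y" "f [] = b'"
    "\<And>w. f (p @ w) = snd (last (y # p @ w))" by blast
  have "\<exists>f\<in>treehom (list_arcs X) fst z. f [] = b'" if "(x, z) \<in> list_arcs X" for z
    using list_arcs_side[OF that] sb by (intro list_treehom_exists) auto
  then obtain g where g: "\<And>z. (x, z) \<in> list_arcs X \<Longrightarrow> g z \<in> treehom (list_arcs X) fst z \<and> g z [] = b'"
    by metis
  define g' where "g' = g(y := f)"
  have "(\<lambda>w. case w of [] \<Rightarrow> b | z # w' \<Rightarrow> g' z w') \<in> treehom (list_arcs X) fst x"
    using Cons.prems b' f g by (intro treehom_glue) (auto simp: g'_def)
  then show ?case using f by (intro bexI) (auto simp: g'_def)
qed

text \<open>Induction on the number of prescribed ends. While all of them lie below one child, the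
  value moves on to a neighbour in the list of that child. If they part within the first \<delta>
  steps, every branch carries fewer of them and the induction hypothesis applies. Otherwise they
  share a prefix of length \<delta>, along which \<open>transit\<close> leads from \<open>b\<close>
  to the projection. Ends in \<open>H\<close> may come early, since their lists are
  singletons.\<close>

lemma solve_long_walks:
  assumes "snd x \<in> X (fst x)" "b \<in> X (fst x)" "finite W" "card W \<le> j"
    and "\<And>w. w \<in> W \<Longrightarrow> walk (list_arcs X) x w"
    and "\<And>w. w \<in> W \<Longrightarrow> j * (\<delta> + 1) \<le> length w \<or> fst (last (x # w)) \<in> VH"
  shows "\<exists>f\<in>treehom (list_arcs X) fst x. f [] = b \<and> (\<forall>w\<in>W. f w = snd (last (x # w)))"
  using assms
proof (induction j arbitrary: x b W)
  case 0
  then show ?case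
    using list_treehom_exists[of b x] XD by auto
next
  case (Suc j)
  note outer_IH = Suc.IH
  \<comment> \<open>Here \<open>i\<close> counts steps without branching: either the conditions can
    be met, or they share a prefix of length \<open>i\<close>. The bound equals
    \<open>Suc j * (\<delta> + 1)\<close> for \<open>i = \<delta>\<close> and drops by one with each
    step down.\<close>
  have split: "(\<exists>f\<in>treehom (list_arcs X) fst x. f [] = b \<and> (\<forall>w\<in>W. f w = snd (last (x # w)))) \<or>
      (\<exists>p. length p = i \<and> (\<forall>w\<in>W. \<exists>w'. w = p @ w'))"
    if "snd x \<in> X (fst x)" "b \<in> X (fst x)" "finite W" "card W \<le> Suc j"
      and "\<And>w. w \<in> W \<Longrightarrow> walk (list_arcs X) x w"
      and "\<And>w. w \<in> W \<Longrightarrow> i + 1 + j * (\<delta> + 1) \<le> length w \<or> fst (last (x # w)) \<in> VH" for i x b W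
    using that
  proof (induction i arbitrary: x b W)
    case 0
    then show ?case by auto
  next
    case (Suc i)
    note prems = Suc.prems
    define S where "S x b W \<longleftrightarrow>
      (\<exists>f\<in>treehom (list_arcs X) fst x. f [] = b \<and> (\<forall>w\<in>W. f w = snd (last (x # w))))" for x b W
    define tails where "tails y = {w. y # w \<in> W}" for y
    have tails_image: "Cons y ` tails y \<subseteq> W" for y unfolding tails_def by auto
    have fin_tails: "finite (tails y)" for y
      using tails_image prems(3) by (metis finite_imageD finite_subset inj_on_def list.inject)
    have card_tails: "card (tails y) = card (Cons y ` tails y)" for y by (simp add: card_image)
    have glue: "S x b W" if ne: "[] \<notin> W"
      and sub: "\<And>y. (x, y) \<in> list_arcs X \<Longrightarrow> \<exists>c. (b, c) \<in> E \<and> S y c (tails y)"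
    proof -
      obtain c g where g: "\<And>y. (x, y) \<in> list_arcs X \<Longrightarrow> (b, c y) \<in> E \<and>
          g y \<in> treehom (list_arcs X) fst y \<and> g y [] = c y \<and> (\<forall>w\<in>tails y. g y w = snd (last (y # w)))"
        using sub unfolding S_def by metis
      let ?f = "\<lambda>w. case w of [] \<Rightarrow> b | y # w' \<Rightarrow> g y w'"
      have "?f \<in> treehom (list_arcs X) fst x"
        using g prems XD by (intro treehom_glue) auto
      moreover have "?f w = snd (last (x # w))" if w: "w \<in> W" for w
      proof (cases w)
        case Nil
        then show ?thesis using ne w by simp
      next
        case (Cons y w')
        then have "(x, y) \<in> list_arcs X" "w' \<in> tails y"
          using prems(5)[OF w] w by (auto simp: tails_def)
        then show ?thesis using g Cons by auto
      qed
      ultimately show ?thesis unfolding S_def by (intro bexI[of _ ?f]) auto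
    qed
    have free: "\<exists>c. (b, c) \<in> E \<and> S y c {}" if "(x, y) \<in> list_arcs X" for y
      using list_treehom_exists[of "nbr b" y] nbr[of b] E_VH E_side[of b "nbr b"]
        list_arcs_side[OF that] prems XD unfolding S_def by (intro exI[of _ "nbr b"]) auto
    have next_value: "\<exists>c\<in>X (fst y). (b, c) \<in> E" if "(x, y) \<in> list_arcs X" for y
      using list_arcsD[OF that] XD(4) prems by blast
    have tail_walk: "walk (list_arcs X) y w \<and>
        (i + 1 + j * (\<delta> + 1) \<le> length w \<or> fst (last (y # w)) \<in> VH)" if "w \<in> tails y" for y w
      using prems(5,6)[of "y # w"] that unfolding tails_def by auto
    have "S x b W \<or> (\<exists>p. length p = Suc i \<and> (\<forall>w\<in>W. \<exists>w'. w = p @ w'))"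
    proof (cases "[] \<in> W")
      case True
      \<comment> \<open>The empty walk is too short to satisfy the length bound.\<close>
      then have "fst x \<in> VH" using prems(6)[of "[]"] by auto
      then have "b = snd x" using prems XD by auto
      then have "S x b W" unfolding S_def by (intro bexI[OF _ projection_treehom[OF prems(1)]]) auto
      then show ?thesis ..
    next
      case ne: False
      show ?thesis
      proof (cases "\<exists>y. \<forall>w\<in>W. hd w = y")
        case True
        then obtain y where y: "\<And>w. w \<in> W \<Longrightarrow> hd w = y" by blast
        have "w \<in> Cons y ` tails y" if "w \<in> W" for w
          using y[OF that] ne that unfolding tails_def by (cases w) auto
        then have W: "W = Cons y ` tails y" using tails_image by blast
        show ?thesis
        proof (cases "(x, y) \<in> list_arcs X")
          case False
          then have "W = {}" using W prems(5) by force
          then have "tails z = {}" for z unfolding tails_def by simp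
          then show ?thesis using glue[OF ne] free by simp
        next
          case xy: True
          obtain c where c: "c \<in> X (fst y)" "(b, c) \<in> E" using next_value[OF xy] by blast
          have "S y c (tails y) \<or> (\<exists>p. length p = i \<and> (\<forall>w\<in>tails y. \<exists>w'. w = p @ w'))"
            unfolding S_def
            using list_arcsD[OF xy] c fin_tails card_tails[of y] W prems(4) tail_walk
            by (intro Suc.IH) auto
          then show ?thesis
          proof
            assume "S y c (tails y)"
            moreover have "tails z = {}" if "z \<noteq> y" for z using that W unfolding tails_def by auto
            ultimately show ?thesis using glue[OF ne] c free by metis
          next
            assume "\<exists>p. length p = i \<and> (\<forall>w\<in>tails y. \<exists>w'. w = p @ w')"
            then obtain p where "length p = i" "\<forall>w\<in>tails y. \<exists>w'. w = p @ w'" by blast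
            then have "length (y # p) = Suc i \<and> (\<forall>w\<in>W. \<exists>w'. w = (y # p) @ w')" using W by auto
            then show ?thesis by blast
          qed
        qed
      next
        case False
        have "\<exists>c. (b, c) \<in> E \<and> S y c (tails y)" if xy: "(x, y) \<in> list_arcs X" for y
        proof -
          obtain c where c: "c \<in> X (fst y)" "(b, c) \<in> E" using next_value[OF xy] by blast
          \<comment> \<open>The conditions part here, so no child carries all of them and at most
            \<open>j\<close> remain below each.\<close>
          have "Cons y ` tails y \<noteq> W" using False by (metis imageE list.sel(1))
          then have "card (Cons y ` tails y) < card W"
            using tails_image[of y] prems(3) by (intro psubset_card_mono psubsetI)
          then have "card (tails y) \<le> j" using card_tails[of y] prems(4) by simp
          moreover have "j * (\<delta> + 1) \<le> length w \<or> fst (last (y # w)) \<in> VH" if "w \<in> tails y" for w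
            using tail_walk[OF that] by linarith
          ultimately have "S y c (tails y)"
            unfolding S_def using list_arcsD[OF xy] c fin_tails tail_walk
            by (intro outer_IH) blast+
          then show ?thesis using c by blast
        qed
        then show ?thesis using glue[OF ne] by blast
      qed
    qed
    then show ?case unfolding S_def .
  qed
  consider f where "f \<in> treehom (list_arcs X) fst x" "f [] = b" "\<forall>w\<in>W. f w = snd (last (x # w))"
    | p where "length p = \<delta>" "\<forall>w\<in>W. \<exists>w'. w = p @ w'"
    using split[of x b W \<delta>] Suc.prems by fastforce
  then show ?case
  proof cases
    case 1
    then show ?thesis by blast
  next
    case (2 p)
    show ?thesis
    proof (cases "W = {}")
      case True
      then show ?thesis using list_treehom_exists[of b x] Suc.prems XD by auto
    next
      case False
      then have p: "walk (list_arcs X) x p" using 2 Suc.prems(5) by (force simp: walk_append)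
      \<comment> \<open>The values \<open>b\<close> and \<open>snd x\<close> lie in the same list,
        hence on the same side; so the walk \<open>p\<close> itself shows that the parity is
        right.\<close>
      have "(b, snd (last (x # p))) \<in> E ^^ length p"
        using 2 Suc.prems(1,2) XD(1,2) list_walk_end[OF p] relpow_side[OF list_walk_relpow[OF p]]
        by (intro E_walk) auto
      from transit[OF p this] Suc.prems(1,2) XD(1,2) obtain f where
        "f \<in> treehom (list_arcs X) fst x" "f [] = b" "\<forall>w. f (p @ w) = snd (last (x # p @ w))"
        by auto
      then show ?thesis using 2 by fastforce
    qed
  qed
qed

end

end

context nu_extension begin

subsection \<open>Rigid lists\<close>

text \<open>An idempotent endomorphism of the graph \<open>list_arcs L\<close> that keeps first
  components, written fibrewise.\<close>

definition list_retraction :: "('a \<Rightarrow> 'a set) \<Rightarrow> ('a \<Rightarrow> 'a \<Rightarrow> 'a) \<Rightarrow> bool" where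
  "list_retraction L \<rho> \<longleftrightarrow> (\<forall>g\<in>VG. \<forall>a\<in>L g. \<rho> g a \<in> L g \<and> \<rho> g (\<rho> g a) = \<rho> g a) \<and>
     (\<forall>u v a c. (u, v) \<in> EG \<longrightarrow> a \<in> L u \<longrightarrow> c \<in> L v \<longrightarrow> (a, c) \<in> E \<longrightarrow> (\<rho> u a, \<rho> v c) \<in> E)"

text \<open>A fold as in dismantling: among the images of \<rho> every neighbour of \<open>a\<close>
  is also a neighbour of \<open>a'\<close>, so \<open>a\<close> may be sent to \<open>a'\<close>
  after \<rho>. An arc never joins \<open>u\<close> to itself, so at most one end of an arc is
  changed.\<close>

lemma list_retraction_fold:
  assumes \<rho>: "list_retraction L \<rho>" and u: "u \<in> VG" and aa': "a \<in> L u" "a' \<in> L u" "\<rho> u a = a" "\<rho> u a' = a'"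
    and dom: "\<And>v c. (u, v) \<in> EG \<Longrightarrow> c \<in> L v \<Longrightarrow> \<rho> v c = c \<Longrightarrow> (a, c) \<in> E \<Longrightarrow> (a', c) \<in> E" and "a \<noteq> a'"
  shows "list_retraction L (\<rho>(u := \<lambda>z. if \<rho> u z = a then a' else \<rho> u z))"
proof -
  let ?\<rho> = "\<rho>(u := \<lambda>z. if \<rho> u z = a then a' else \<rho> u z)"
  have EG_L: "v \<in> VG" "w \<in> VG" "v \<noteq> w" if "(v, w) \<in> EG" for v w using that EG_VG EG_side by auto
  have \<rho>D: "\<rho> g b \<in> L g" "\<rho> g (\<rho> g b) = \<rho> g b" if "g \<in> VG" "b \<in> L g" for g b
    using \<rho> that unfolding list_retraction_def by blast+
  have \<rho>E: "(\<rho> v b, \<rho> w c) \<in> E" if "(v, w) \<in> EG" "b \<in> L v" "c \<in> L w" "(b, c) \<in> E" for v w b c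
    using \<rho> that unfolding list_retraction_def by blast
  have "?\<rho> g b \<in> L g \<and> ?\<rho> g (?\<rho> g b) = ?\<rho> g b" if "g \<in> VG" "b \<in> L g" for g b
    using \<rho>D[OF that] aa' \<open>a \<noteq> a'\<close> by (cases "g = u") auto
  moreover have "(?\<rho> v b, ?\<rho> w c) \<in> E" if vw: "(v, w) \<in> EG" and bc: "b \<in> L v" "c \<in> L w" "(b, c) \<in> E" for v w b c
  proof -
    note e = \<rho>E[OF vw bc] EG_L[OF vw]
    consider "v = u" "\<rho> v b = a" | "w = u" "\<rho> w c = a" | "v \<noteq> u \<or> \<rho> v b \<noteq> a" "w \<noteq> u \<or> \<rho> w c \<noteq> a" by blast
    then show ?thesis
    proof cases
      case 1
      then have "(a', \<rho> w c) \<in> E" using e dom[of w "\<rho> w c"] \<rho>D[of w c] vw bc by auto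
      then show ?thesis using 1 e by auto
    next
      case 2
      then have "(a', \<rho> v b) \<in> E" using e dom[of v "\<rho> v b"] \<rho>D[of v b] vw bc EG_sym E_sym by auto
      then show ?thesis using 2 e E_sym by auto
    next
      case 3
      then show ?thesis using e by auto
    qed
  qed
  ultimately show ?thesis unfolding list_retraction_def by blast
qed

text \<open>Take a retraction whose images have minimal total size. If no neighbour told
  \<open>a\<close> from \<open>a'\<close>, folding \<open>a\<close> to \<open>a'\<close> would
  remove \<open>a\<close> from the image at \<open>u\<close> and add nothing.\<close>

lemma ex_rigid_retraction:
  assumes fin: "\<And>g. finite (L g)"
  shows "\<exists>\<rho>. list_retraction L \<rho> \<and> (\<forall>u\<in>VG. \<forall>a\<in>L u. \<forall>a'\<in>L u. \<rho> u a = a \<longrightarrow> \<rho> u a' = a' \<longrightarrow> a \<noteq> a' \<longrightarrow>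
    (\<exists>v c. (u, v) \<in> EG \<and> c \<in> L v \<and> \<rho> v c = c \<and> (a, c) \<in> E \<and> (a', c) \<notin> E))"
proof -
  define \<mu> where "\<mu> \<rho> = (\<Sum>g\<in>VG. card (\<rho> g ` L g))" for \<rho> :: "'a \<Rightarrow> 'a \<Rightarrow> 'a"
  have "list_retraction L (\<lambda>_ a. a)" unfolding list_retraction_def by simp
  then obtain \<rho> where \<rho>: "list_retraction L \<rho>" and least: "\<And>\<rho>'. list_retraction L \<rho>' \<Longrightarrow> \<mu> \<rho> \<le> \<mu> \<rho>'"
    using ex_has_least_nat[of "list_retraction L" _ \<mu>] by blast
  have \<rho>D: "\<rho> g b \<in> L g" "\<rho> g (\<rho> g b) = \<rho> g b" if "g \<in> VG" "b \<in> L g" for g b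
    using \<rho> that unfolding list_retraction_def by blast+
  have "\<exists>v c. (u, v) \<in> EG \<and> c \<in> L v \<and> \<rho> v c = c \<and> (a, c) \<in> E \<and> (a', c) \<notin> E"
    if u: "u \<in> VG" and a: "a \<in> L u" "a' \<in> L u" "\<rho> u a = a" "\<rho> u a' = a'" "a \<noteq> a'" for u a a'
  proof (rule ccontr)
    assume neg: "\<not> ?thesis"
    define \<rho>' where "\<rho>' = \<rho>(u := \<lambda>z. if \<rho> u z = a then a' else \<rho> u z)"
    have "list_retraction L \<rho>'" unfolding \<rho>'_def
      by (rule list_retraction_fold[OF \<rho> u]) (use a neg in blast)+
    then have "\<mu> \<rho> \<le> \<mu> \<rho>'" by (rule least)
    moreover have "\<mu> \<rho>' < \<mu> \<rho>" unfolding \<mu>_def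
    proof (rule sum_strict_mono_ex1[OF finite_VG])
      have sub: "\<rho>' u ` L u \<subset> \<rho> u ` L u"
      proof
        show "\<rho>' u ` L u \<subseteq> \<rho> u ` L u" unfolding \<rho>'_def using a by (auto intro: rev_image_eqI)
        have "a \<in> \<rho> u ` L u" "a \<notin> \<rho>' u ` L u" unfolding \<rho>'_def using a by (force, auto)
        then show "\<rho>' u ` L u \<noteq> \<rho> u ` L u" by blast
      qed
      then have "card (\<rho>' u ` L u) < card (\<rho> u ` L u)" using fin by (intro psubset_card_mono) auto
      moreover have "\<rho>' g = \<rho> g" if "g \<noteq> u" for g using that unfolding \<rho>'_def by simp
      ultimately show "\<forall>g\<in>VG. card (\<rho>' g ` L g) \<le> card (\<rho> g ` L g)"
        "\<exists>g\<in>VG. card (\<rho>' g ` L g) < card (\<rho> g ` L g)" using u by (metis le_refl less_imp_le, blast)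
    qed
    ultimately show False by simp
  qed
  then show ?thesis using \<rho> by blast
qed

text \<open>In the tree of walks from \<open>(g, a)\<close>, the value \<open>b\<close> at the root
  is compatible with the projection at depth \<open>d\<close> and at the ends in \<open>H\<close>.
  Rigidity carries the projection from depth \<open>d\<close> back up to the root, where it forces
  \<open>a\<close>.\<close>

lemma rigid_singleton:
  assumes X: "consistent X" and L: "\<And>g. g \<in> VG \<Longrightarrow> L g = lev n g"
    and \<rho>: "list_retraction L \<rho>" and XL: "\<And>g. g \<in> VG \<Longrightarrow> X g = {a \<in> L g. \<rho> g a = a}"
    and rigid: "\<And>u a a'. u \<in> VG \<Longrightarrow> a \<in> X u \<Longrightarrow> a' \<in> X u \<Longrightarrow> a \<noteq> a' \<Longrightarrow>
       \<exists>v c. (u, v) \<in> EG \<and> c \<in> X v \<and> (a, c) \<in> E \<and> (a', c) \<notin> E"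
    and g: "g \<in> VG" "a \<in> X g" "b \<in> X g"
  shows "a = b"
proof (rule ccontr)
  assume "a \<noteq> b"
  note XD = XD[OF X]
  let ?R = "list_arcs X" and ?x = "(g, a)"
  \<comment> \<open>The successor makes \<open>d\<close> positive: a walk of length \<open>d\<close>
    is never the root, where \<open>b\<close> is prescribed instead of \<phi>.\<close>
  define d where "d = Suc (k * (\<delta> + 1))"
  define \<phi> where "\<phi> w = snd (last (?x # w))" for w :: "('a \<times> 'a) list"
  define Y where "Y = {y. fst y \<in> VG \<and> snd y \<in> X (fst y)}"
  have gH: "g \<notin> VH" using XD(3)[of g] g \<open>a \<noteq> b\<close> by auto
  have xY: "?x \<in> Y" and RY: "\<And>y y'. (y, y') \<in> ?R \<Longrightarrow> y' \<in> Y"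
    unfolding Y_def using g EG_VG by (auto dest: list_arcsD)
  have walk_Y: "last (?x # w) \<in> Y" if "walk ?R ?x w" for w
    using that by (induction rule: walk_induct_rev) (use xY RY in auto)
  \<comment> \<open>Ends in \<open>H\<close> are prescribed for \<open>n\<close> further levels
    below depth \<open>d\<close>, so that all values of \<open>f\<close> down to depth
    \<open>d\<close> survive \<open>n\<close> rounds and lie in the lists \<open>L\<close>, where
    \<rho> acts.\<close>
  define C where "C = {w. walk ?R ?x w \<and> (w = [] \<or> length w = d \<or>
      length w \<le> d + n \<and> fst (last (?x # w)) \<in> VH)}"
  define c where "c w = (if w = [] then b else \<phi> w)" for w
  have "finite {w. walk ?R ?x w \<and> length w \<le> d + n}"
  proof (rule finite_walks)
    show "finite (VG \<times> VH)" using finite_VG finite_VH by simp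
    show "?R \<subseteq> (VG \<times> VH) \<times> (VG \<times> VH)" unfolding list_arcs_def using EG_VG E_VH by auto
  qed
  then have finC: "finite C" by (rule rev_finite_subset) (auto simp: C_def)
  have "\<exists>f\<in>treehom ?R fst ?x. \<forall>w\<in>C. f w = c w"
  proof (rule nu_closed_extend[OF treehom_nu_closed finC])
    fix C' assume C': "C' \<subseteq> C" "card C' \<le> k"
    then have fin: "finite C'" using finC finite_subset by blast
    show "\<exists>f\<in>treehom ?R fst ?x. \<forall>w\<in>C'. f w = c w"
    proof (cases "[] \<in> C'")
      case True
      have "\<exists>f\<in>treehom ?R fst ?x. f [] = b \<and> (\<forall>w\<in>C' - {[]}. f w = snd (last (?x # w)))"
      proof (rule solve_long_walks[OF X])
        show "card (C' - {[]}) \<le> k" using C'(2) fin by (meson card_Diff1_le le_trans)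
        show "k * (\<delta> + 1) \<le> length w \<or> fst (last (?x # w)) \<in> VH" if "w \<in> C' - {[]}" for w
          using that C' unfolding C_def d_def by auto
      qed (use g fin C' in \<open>auto simp: C_def\<close>)
      then show ?thesis unfolding c_def \<phi>_def by (metis DiffI singletonD)
    next
      case False
      then have "\<forall>w\<in>C'. \<phi> w = c w" unfolding c_def by auto
      moreover have "\<phi> \<in> treehom ?R fst ?x"
        unfolding \<phi>_def using projection_treehom[OF X, of ?x] g by simp
      ultimately show ?thesis by blast
    qed
  qed (auto simp: C_def)
  then obtain f where f: "f \<in> treehom ?R fst ?x" and fC: "\<And>w. w \<in> C \<Longrightarrow> f w = c w" by blast
  have levf: "f w \<in> L (fst (last (?x # w)))" if w: "walk ?R ?x w" "length w \<le> d" for w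
  proof -
    have "f w \<in> lev n (fst (last (?x # w)))"
    proof (rule lev_of_solution[OF f _ xY RY])
      show "\<exists>y'. (y, y') \<in> ?R \<and> fst y' = g'" if y: "y \<in> Y" "(fst y, g') \<in> EG" for y g'
      proof -
        obtain a' where "a' \<in> X g'" "(snd y, a') \<in> E" using y XD(4) unfolding Y_def by blast
        then have "(y, (g', a')) \<in> ?R" using y unfolding list_arcs_def Y_def by (cases y) auto
        then show ?thesis by auto
      qed
      show "f w = fst (last (?x # w))"
        if w: "walk ?R ?x w" "length w \<le> d + n" "fst (last (?x # w)) \<in> VH" for w
      proof -
        have "w \<in> C" "w \<noteq> []" unfolding C_def using w gH by auto
        moreover have "\<phi> w = fst (last (?x # w))"
          using walk_Y[OF w(1)] XD(3)[OF w(3)] unfolding Y_def \<phi>_def by auto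
        ultimately show ?thesis using fC[of w] unfolding c_def by auto
      qed
    qed (use w in auto)
    then show ?thesis using L walk_Y[OF w(1)] unfolding Y_def by auto
  qed
  \<comment> \<open>Induction upwards from depth \<open>d\<close>. A wrong value at \<open>w\<close>
    would miss some list neighbour \<open>z\<close> of \<open>\<phi> w\<close>; but the child that
    continues to \<open>z\<close> is already forced to be \<open>z\<close>.\<close>
  have forced: "\<rho> (fst (last (?x # w))) (f w) = \<phi> w" if "walk ?R ?x w" "length w \<le> d" for w
    using that
  proof (induction "d - length w" arbitrary: w)
    case 0
    then have "w \<in> C" "w \<noteq> []" unfolding C_def d_def by auto
    then have "f w = \<phi> w" using fC[of w] unfolding c_def by auto
    then show ?case using walk_Y[OF 0(2)] XL unfolding Y_def \<phi>_def by auto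
  next
    case (Suc i)
    let ?y = "last (?x # w)"
    have y: "fst ?y \<in> VG" "\<phi> w \<in> X (fst ?y)"
      using walk_Y[OF Suc.prems(1)] unfolding Y_def \<phi>_def by auto
    have fw: "\<rho> (fst ?y) (f w) \<in> X (fst ?y)"
      using levf[OF Suc.prems] \<rho> y XL unfolding list_retraction_def by blast
    show ?case
    proof (rule ccontr)
      assume "\<rho> (fst ?y) (f w) \<noteq> \<phi> w"
      then obtain v z where v: "(fst ?y, v) \<in> EG" "z \<in> X v" "(\<phi> w, z) \<in> E" "(\<rho> (fst ?y) (f w), z) \<notin> E"
        using rigid[OF y(1,2) fw] by metis
      then have arc: "(?y, (v, z)) \<in> ?R" using y unfolding list_arcs_def \<phi>_def by (cases ?y) auto
      then have w': "walk ?R ?x (w @ [(v, z)])" "length (w @ [(v, z)]) \<le> d"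
        using Suc.prems Suc.hyps(2) by (auto simp: walk_append)
      have "\<rho> v (f (w @ [(v, z)])) = z"
        using Suc.hyps(1)[OF _ w'] Suc.hyps(2) unfolding \<phi>_def by auto
      moreover have "(\<rho> (fst ?y) (f w), \<rho> v (f (w @ [(v, z)]))) \<in> E"
        using \<rho> v(1) levf[OF Suc.prems] levf[OF w'] treehomD(3)[OF f Suc.prems(1) arc]
        unfolding list_retraction_def by auto
      ultimately show False using v by simp
    qed
  qed
  have "f [] = b" using fC[of "[]"] unfolding C_def c_def by simp
  then have "\<rho> g b = a" using forced[of "[]"] unfolding \<phi>_def by simp
  then show False using XL g \<open>a \<noteq> b\<close> by auto
qed

theorem finite_retraction:
  assumes few: "\<And>g W. g \<in> VG - VH \<Longrightarrow> finite W \<Longrightarrow> card W \<le> k \<Longrightarrow>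
      \<forall>w\<in>W. walk stop_arcs g w \<and> last (g # w) \<in> VH \<Longrightarrow>
      \<exists>f\<in>treehom stop_arcs id g. \<forall>w\<in>W. f w = last (g # w)"
  shows "\<exists>r. (\<forall>g\<in>VG. r g \<in> VH) \<and> (\<forall>(u, v)\<in>EG. (r u, r v) \<in> E) \<and> (\<forall>h\<in>VH. r h = h)"
proof -
  obtain n where n: "\<And>g. g \<in> VG \<Longrightarrow> lev (Suc n) g = lev n g" using lev_stabilises by blast
  have ne: "lev n g \<noteq> {}" if "g \<in> VG" for g
    using that lev_VH few lev_nonempty by (cases "g \<in> VH") auto
  have lev_step: "\<exists>c\<in>lev n v. (a, c) \<in> E" if uv: "(u, v) \<in> EG" and a: "a \<in> lev n u" for u v a
  proof (cases "u \<in> VH")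
    case False
    then show ?thesis using a n[of u] uv EG_VG by auto
  next
    case u: True
    show ?thesis
    proof (cases "v \<in> VH")
      case True
      then show ?thesis using a uv u EG_E lev_VH by auto
    next
      case False
      \<comment> \<open>The list of \<open>u\<close> is never pruned, so the condition is read off
        at \<open>v\<close>: its candidates must have a neighbour in the list
        \<open>{u}\<close>.\<close>
      have v: "v \<in> VG" "(v, u) \<in> EG" using uv EG_VG EG_sym by auto
      obtain c where c: "c \<in> lev n v" using ne[OF v(1)] by blast
      then have "c \<in> lev (Suc n) v" using n[OF v(1)] by simp
      then have "(c, u) \<in> E" using False v(2) u by (auto simp: lev_VH)
      then show ?thesis using c E_sym a u by (auto simp: lev_VH)
    qed
  qed
  have fin: "finite (lev n g)" for g
    using lev_subset[of n g] finite_VH by (auto intro: finite_subset)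
  from ex_rigid_retraction[of "lev n", OF fin] obtain \<rho> where \<rho>: "list_retraction (lev n) \<rho>"
    and rigid: "\<forall>u\<in>VG. \<forall>a\<in>lev n u. \<forall>a'\<in>lev n u. \<rho> u a = a \<longrightarrow> \<rho> u a' = a' \<longrightarrow> a \<noteq> a' \<longrightarrow>
      (\<exists>v c. (u, v) \<in> EG \<and> c \<in> lev n v \<and> \<rho> v c = c \<and> (a, c) \<in> E \<and> (a', c) \<notin> E)"
    by (elim exE conjE)
  have \<rho>D: "\<rho> g a \<in> lev n g" "\<rho> g (\<rho> g a) = \<rho> g a" if "g \<in> VG" "a \<in> lev n g" for g a
    using \<rho> that unfolding list_retraction_def by blast+
  \<comment> \<open>The lists are made empty outside \<open>VG\<close>, where \<rho> is not
    controlled and no arc of \<open>EG\<close> leads.\<close>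
  define X where "X g = (if g \<in> VG then {a \<in> lev n g. \<rho> g a = a} else {})" for g
  have X: "consistent X"
    unfolding consistent_def
  proof (intro conjI allI ballI impI)
    show "X g \<subseteq> {a \<in> VH. side a = side g}" for g unfolding X_def using lev_subset[of n g] by auto
    show "X h = {h}" if "h \<in> VH" for h
      using that VH_VG \<rho>D(1)[of h h] unfolding X_def by (auto simp: lev_VH)
    show "\<exists>c\<in>X v. (a, c) \<in> E" if uv: "(u, v) \<in> EG" and a: "a \<in> X u" for u v a
    proof -
      have a': "a \<in> lev n u" "\<rho> u a = a" using a unfolding X_def by (auto split: if_splits)
      obtain c where c: "c \<in> lev n v" "(a, c) \<in> E" using lev_step[OF uv a'(1)] by blast
      then have "(\<rho> u a, \<rho> v c) \<in> E" using \<rho> uv a' unfolding list_retraction_def by blast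
      moreover have "\<rho> v c \<in> X v" unfolding X_def using \<rho>D c uv EG_VG by auto
      ultimately show ?thesis using a' by auto
    qed
  qed
  have single: "a = b" if "g \<in> VG" "a \<in> X g" "b \<in> X g" for g a b
  proof (rule rigid_singleton[OF X _ \<rho> _ _ that])
    show "\<exists>v c. (u, v) \<in> EG \<and> c \<in> X v \<and> (a, c) \<in> E \<and> (a', c) \<notin> E"
      if "u \<in> VG" "a \<in> X u" "a' \<in> X u" "a \<noteq> a'" for u a a'
    proof -
      have "a \<in> lev n u" "\<rho> u a = a" "a' \<in> lev n u" "\<rho> u a' = a'"
        using that(1-3) unfolding X_def by auto
      with rigid that(1,4) obtain v c where
        "(u, v) \<in> EG" "c \<in> lev n v" "\<rho> v c = c" "(a, c) \<in> E" "(a', c) \<notin> E" by blast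
      then show ?thesis using EG_VG unfolding X_def by auto
    qed
  qed (auto simp: X_def)
  have Xne: "X g \<noteq> {}" if "g \<in> VG" for g
  proof -
    obtain a where "a \<in> lev n g" using ne[OF \<open>g \<in> VG\<close>] by blast
    then have "\<rho> g a \<in> X g" unfolding X_def using \<rho>D that by auto
    then show ?thesis by blast
  qed
  define r where "r g = (SOME a. a \<in> X g)" for g
  have r: "r g \<in> X g" if "g \<in> VG" for g unfolding r_def using Xne[OF that] some_in_eq by blast
  have "(r u, r v) \<in> E" if uv: "(u, v) \<in> EG" for u v
  proof -
    have uv': "u \<in> VG" "v \<in> VG" using uv EG_VG by auto
    then obtain c where "c \<in> X v" "(r u, c) \<in> E" using XD(4)[OF X uv r] by blast
    then show ?thesis using single[OF uv'(2) _ r] uv' by metis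
  qed
  moreover have "r h = h" if "h \<in> VH" for h using r[of h] XD(3)[OF X that] that VH_VG by auto
  ultimately show ?thesis using r XD(1)[OF X] by blast
qed

end

subsection \<open>Walks and distances\<close>

text \<open>Connectedness is defined as strong connectedness of the symmetric closure, which for a
  symmetric graph is the graph itself.\<close>

lemma connected_rtrancl:
  assumes "pair_sym_digraph G" "Digraph_Component.connected (with_proj G)"
  shows "pverts G \<noteq> {}" "u \<in> pverts G \<Longrightarrow> v \<in> pverts G \<Longrightarrow> (u, v) \<in> (parcs G)\<^sup>*"
proof -
  interpret pair_sym_digraph G by fact
  have "parcs (mk_symmetric (with_proj G)) = parcs G"
    using adj_mk_symmetric_eq[OF sym_arcs] .
  then have "mk_symmetric (with_proj G) = G" unfolding mk_symmetric_def by (cases G) auto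
  then have sc: "strongly_connected (with_proj G)" using assms(2) unfolding Digraph_Component.connected_def by simp
  then show "pverts G \<noteq> {}" unfolding strongly_connected_def by simp
  assume "u \<in> pverts G" "v \<in> pverts G"
  then have "u \<rightarrow>\<^sup>*\<^bsub>with_proj G\<^esub> v" using sc unfolding strongly_connected_def by simp
  then show "(u, v) \<in> (parcs G)\<^sup>*"
    unfolding reachable_def by (auto dest: rtrancl_on_rtranclI)
qed

lemma reachableI_rtrancl:
  assumes "pair_wf_digraph G" "(u, v) \<in> (parcs G)\<^sup>*" "u \<in> pverts G"
  shows "\<exists>p. pre_digraph.awalk (with_proj G) u p v"
proof -
  interpret pair_wf_digraph G by fact
  show ?thesis using assms(2)
  proof induction
    case base
    then show ?case using assms(3) by (metis awalk_Nil_iff)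
  next
    case (step y z)
    then obtain p where "awalk u p y" by blast
    moreover have "awalk y [(y, z)] z"
      using step by (auto simp: awalk_simps intro: in_arcsD2)
    ultimately show ?case using awalk_appendI by blast
  qed
qed

lemma connectedI_rtrancl:
  assumes "pair_sym_digraph G" "pverts G \<noteq> {}"
    and "\<And>u v. u \<in> pverts G \<Longrightarrow> v \<in> pverts G \<Longrightarrow> (u, v) \<in> (parcs G)\<^sup>*"
  shows "Digraph_Component.connected (with_proj G)"
proof -
  interpret pair_sym_digraph G by fact
  have "parcs (mk_symmetric (with_proj G)) = parcs G"
    using adj_mk_symmetric_eq[OF sym_arcs] .
  then have "mk_symmetric (with_proj G) = G" unfolding mk_symmetric_def by (cases G) auto
  moreover have "strongly_connected (with_proj G)"
    unfolding strongly_connected_def reachable_awalk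
    using assms(2,3) reachableI_rtrancl[OF pair_wf_digraph_axioms] by simp
  ultimately show ?thesis unfolding Digraph_Component.connected_def by simp
qed

lemma pcas_side:
  assumes "\<And>u v. (u, v) \<in> set p \<Longrightarrow> side u \<noteq> (side v :: bool)" "pcas u p v"
  shows "even (length p) \<longleftrightarrow> side u = side v"
  using assms
proof (induction p arbitrary: u)
  case (Cons e p)
  have "even (length p) \<longleftrightarrow> side (snd e) = side v" using Cons.prems by (intro Cons.IH) auto
  moreover have "side u \<noteq> side (snd e)" using Cons.prems by (cases e) auto
  ultimately show ?case by auto
qed simp

text \<open>The distance is the length of some path, and each step changes sides. This turns the
  parity condition of \<open>H_tree\<close> into a statement about sides.\<close>

lemma graph_dist_side:
  assumes "pair_wf_digraph G" "\<And>u v. (u, v) \<in> parcs G \<Longrightarrow> side u \<noteq> (side v :: bool)"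
    and "(u, v) \<in> (parcs G)\<^sup>*" "u \<in> pverts G"
  shows "even (graph_dist G u v) \<longleftrightarrow> side u = side v"
proof -
  interpret pair_wf_digraph G by fact
  have "\<exists>p. apath u p v" using reachableI_rtrancl[OF assms(1,3,4)] apath_awalk_to_apath by blast
  then have "\<exists>p. apath u p v \<and> length p = graph_dist G u v"
    unfolding graph_dist_def by (rule_tac LeastI_ex) blast
  then obtain p where "apath u p v" "length p = graph_dist G u v" by blast
  then show ?thesis using pcas_side[of p side u v] assms(2) unfolding apath_def awalk_def by auto
qed

subsection \<open>Rooted trees\<close>

text \<open>The depth certifies that iterating \<open>par\<close> ends in \<open>r\<close>, since it
  cannot decrease forever.\<close>

definition rooted :: "'a set \<Rightarrow> 'a \<Rightarrow> ('a \<Rightarrow> 'a) \<Rightarrow> ('a \<Rightarrow> nat) \<Rightarrow> bool" where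
  "rooted V r par dep \<longleftrightarrow> r \<in> V \<and> (\<forall>v\<in>V - {r}. par v \<in> V \<and> dep v = Suc (dep (par v)))"

definition parent_graph :: "'a set \<Rightarrow> 'a \<Rightarrow> ('a \<Rightarrow> 'a) \<Rightarrow> 'a pair_pre_digraph" where
  "parent_graph V r par = \<lparr> pverts = V,
     parcs = {(u, v). u \<in> V \<and> v \<in> V \<and> (v \<noteq> r \<and> par v = u \<or> u \<noteq> r \<and> par u = v)} \<rparr>"

lemma rootedD:
  assumes "rooted V r par dep"
  shows "r \<in> V" "v \<in> V \<Longrightarrow> v \<noteq> r \<Longrightarrow> par v \<in> V" "v \<in> V \<Longrightarrow> v \<noteq> r \<Longrightarrow> dep v = Suc (dep (par v))"
  using assms unfolding rooted_def by blast+

lemma rooted_induct [consumes 2, case_names root step]: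
  assumes "rooted V r par dep" "v \<in> V"
    and "P r" "\<And>v. v \<in> V \<Longrightarrow> v \<noteq> r \<Longrightarrow> P (par v) \<Longrightarrow> P v"
  shows "P v"
  using assms(2)
proof (induction "dep v" arbitrary: v)
  case 0
  then show ?case using assms(3) rootedD(3)[OF assms(1), of v] by force
next
  case (Suc n)
  then show ?case using assms(3,4) rootedD(2,3)[OF assms(1), of v] by (cases "v = r") auto
qed

lemma pcas_nth:
  "pcas u p v \<Longrightarrow> i < length p \<Longrightarrow> fst (p ! i) = (if i = 0 then u else snd (p ! (i - 1)))"
  "pcas u p v \<Longrightarrow> p \<noteq> [] \<Longrightarrow> snd (last p) = v"
  by (induction p arbitrary: u i) (auto simp: nth_Cons split: nat.splits)

lemma parent_graph_bidirected:
  assumes "rooted V r par dep"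
  shows "pair_bidirected_digraph (parent_graph V r par)"
proof unfold_locales
  let ?T = "parent_graph V r par"
  show "fst e \<in> pverts ?T" "snd e \<in> pverts ?T" if "e \<in> parcs ?T" for e
    using that unfolding parent_graph_def by auto
  show "symmetric (with_proj ?T)"
    unfolding symmetric_def by (auto simp: parent_graph_def sym_def)
  show "fst e \<noteq> snd e" if "e \<in> parcs ?T" for e
    using that rootedD(3)[OF assms, of "fst e"] unfolding parent_graph_def by (cases e) auto
qed

lemma parent_graph_rtrancl:
  assumes "rooted V r par dep" "u \<in> V" "v \<in> V"
  shows "(u, v) \<in> (parcs (parent_graph V r par))\<^sup>*"
proof -
  let ?E = "parcs (parent_graph V r par)"
  have arc: "(v, par v) \<in> ?E" "(par v, v) \<in> ?E" if "v \<in> V" "v \<noteq> r" for v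
    using that rootedD(2)[OF assms(1), of v] unfolding parent_graph_def by auto
  have "(v, r) \<in> ?E\<^sup>* \<and> (r, v) \<in> ?E\<^sup>*" if "v \<in> V" for v
    using assms(1) that
    by (induction rule: rooted_induct)
      (auto intro: arc rtrancl_into_rtrancl converse_rtrancl_into_rtrancl)
  then show ?thesis using assms by (meson rtrancl_trans)
qed

text \<open>Both neighbours on the cycle of a deepest vertex are its parent. On a cycle of length at
  least 3 they stand at different positions, so a vertex is repeated.\<close>

lemma parent_graph_no_cycle:
  assumes T: "rooted V r par dep" and p: "pre_digraph.cycle (with_proj (parent_graph V r par)) p"
  shows "length p < 3"
proof (rule ccontr)
  assume len: "\<not> length p < 3"
  let ?T = "parent_graph V r par" and ?n = "length p"
  interpret pair_bidirected_digraph ?T by (rule parent_graph_bidirected[OF T])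
  obtain u where u: "set p \<subseteq> parcs ?T" "pcas u p u" "distinct (tl (awalk_verts u p))"
    using p unfolding cycle_def awalk_def by auto
  have "p \<noteq> []" using len by auto
  have verts: "tl (awalk_verts u p) = map snd p"
    using u(2) awalk_verts_conv'[of u p u] by auto
  have succ: "fst (p ! (Suc j mod ?n)) = snd (p ! j)" if "j < ?n" for j
  proof (cases "Suc j < ?n")
    case True
    then show ?thesis using pcas_nth(1)[OF u(2) True] by simp
  next
    case False
    then have j: "j = ?n - 1" "Suc j = ?n" using that by auto
    then have "snd (p ! j) = u" using pcas_nth(2)[OF u(2) \<open>p \<noteq> []\<close>] \<open>p \<noteq> []\<close> by (simp add: last_conv_nth)
    then show ?thesis using j pcas_nth(1)[OF u(2), of 0] \<open>p \<noteq> []\<close> by simp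
  qed
  have arc: "(fst (p ! j), snd (p ! j)) \<in> parcs ?T" if "j < ?n" for j using u(1) that by auto
  have up: "w = par v" if "(v, w) \<in> parcs ?T \<or> (w, v) \<in> parcs ?T" "dep w \<le> dep v" for v w
    using that rootedD(3)[OF T, of v] rootedD(3)[OF T, of w] unfolding parent_graph_def by auto
  obtain i where i: "i < ?n" "\<And>j. j < ?n \<Longrightarrow> dep (snd (p ! j)) \<le> dep (snd (p ! i))"
  proof -
    let ?S = "(\<lambda>j. dep (snd (p ! j))) ` {..<?n}"
    have "Max ?S \<in> ?S" using \<open>p \<noteq> []\<close> by (intro Max_in) auto
    moreover have "dep (snd (p ! j)) \<le> Max ?S" if "j < ?n" for j using that by (intro Max_ge) auto
    ultimately show ?thesis using that by fastforce
  qed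
  \<comment> \<open>\<open>a\<close> and \<open>b\<close> are the positions cyclically before and
    after \<open>i\<close>; they coincide only on a cycle of length at most 2.\<close>
  define a where "a = (i + ?n - 1) mod ?n"
  define b where "b = Suc i mod ?n"
  have ab: "a < ?n" "b < ?n" unfolding a_def b_def using \<open>p \<noteq> []\<close> by auto
  have a_alt: "a = (if i = 0 then ?n - 1 else i - 1)" unfolding a_def using i(1) len by (auto simp: mod_if)
  have b_alt: "b = (if Suc i = ?n then 0 else Suc i)" unfolding b_def using i(1) by auto
  have "a \<noteq> b" using a_alt b_alt len i(1) by (auto split: if_splits)
  have "Suc a mod ?n = i" using a_alt i(1) by auto
  then have "snd (p ! a) = par (snd (p ! i))"
    using succ[OF ab(1)] arc[OF i(1)] i(2)[OF ab(1)] by (intro up) auto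
  moreover have "snd (p ! b) = par (snd (p ! i))"
    using succ[OF i(1)] arc[OF ab(2)] i(2)[OF ab(2)] unfolding b_def by (intro up) auto
  ultimately have "map snd p ! a = map snd p ! b" using ab by simp
  then show False using u(3) verts ab \<open>a \<noteq> b\<close> by (metis length_map nth_eq_iff_index_eq)
qed

lemma undirected_tree_parent_graph:
  assumes "rooted V r par dep"
  shows "undirected_tree (parent_graph V r par)"
proof -
  interpret pair_bidirected_digraph "parent_graph V r par" by (rule parent_graph_bidirected[OF assms])
  have "Digraph_Component.connected (with_proj (parent_graph V r par))"
    using parent_graph_rtrancl[OF assms] rootedD(1)[OF assms]
    by (intro connectedI_rtrancl) (unfold_locales, auto simp: parent_graph_def)
  then show ?thesis
    unfolding undirected_tree_def
    using parent_graph_bidirected[OF assms] parent_graph_no_cycle[OF assms] by (meson not_le)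
qed

text \<open>Depth is the distance from \<open>r\<close>, and the parent is a neighbour one step
  closer. Any further arc would close a path of the parent graph to a cycle.\<close>

lemma undirected_tree_rooted:
  assumes T: "undirected_tree T" and r: "r \<in> pverts T"
  shows "\<exists>par dep. rooted (pverts T) r par dep \<and> T = parent_graph (pverts T) r par"
proof -
  interpret pair_bidirected_digraph T using T unfolding undirected_tree_def by blast
  have reach: "(r, v) \<in> (parcs T)\<^sup>*" if "v \<in> pverts T" for v
    using connected_rtrancl(2)[OF pair_sym_digraph_axioms _ r that] T unfolding undirected_tree_def by blast
  define dep where "dep v = (LEAST n. (r, v) \<in> parcs T ^^ n)" for v
  have dep: "(r, v) \<in> parcs T ^^ dep v" if "v \<in> pverts T" for v
    unfolding dep_def using reach[OF that] rtrancl_imp_relpow by (metis LeastI)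
  have dep_le: "dep v \<le> n" if "(r, v) \<in> parcs T ^^ n" for v n
    unfolding dep_def using that by (rule Least_le)
  have "\<exists>u. (u, v) \<in> parcs T \<and> dep v = Suc (dep u)" if v: "v \<in> pverts T" "v \<noteq> r" for v
  proof (cases "dep v")
    case 0
    then show ?thesis using dep[OF v(1)] v(2) by simp
  next
    case (Suc n)
    then obtain u where u: "(r, u) \<in> parcs T ^^ n" "(u, v) \<in> parcs T" using dep[OF v(1)] by auto
    then have "(r, v) \<in> parcs T ^^ Suc (dep u)" using dep[of u] in_arcsD1 by auto
    then have "dep v \<le> Suc (dep u)" by (rule dep_le)
    then show ?thesis using u dep_le[OF u(1)] Suc by force
  qed
  then obtain par where par: "\<And>v. v \<in> pverts T \<Longrightarrow> v \<noteq> r \<Longrightarrow> (par v, v) \<in> parcs T \<and> dep v = Suc (dep (par v))"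
    by metis
  then have root: "rooted (pverts T) r par dep" unfolding rooted_def using r in_arcsD1 by blast
  let ?S = "parent_graph (pverts T) r par"
  interpret S: pair_bidirected_digraph ?S by (rule parent_graph_bidirected[OF root])
  have sub: "parcs ?S \<subseteq> parcs T" unfolding parent_graph_def using par arcs_symmetric[OF conjunct1[OF par]] by auto
  have "(u, v) \<in> parcs ?S" if uv: "(u, v) \<in> parcs T" for u v
  proof (rule ccontr)
    assume not: "(u, v) \<notin> parcs ?S"
    have V: "u \<in> pverts T" "v \<in> pverts T" "u \<noteq> v" using uv in_arcsD1 in_arcsD2 pair_no_loops by fastforce+
    obtain p where "S.awalk u p v"
      using reachableI_rtrancl[OF S.pair_wf_digraph_axioms parent_graph_rtrancl[OF root V(1,2)]] V(1)
      unfolding parent_graph_def by auto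
    then obtain q where q: "S.apath u q v" using S.apath_awalk_to_apath by blast
    then have walk: "awalk u q v" and dist: "distinct (pawalk_verts u q)"
      using sub V(1) unfolding S.apath_def S.awalk_def awalk_def by auto
    have "q \<noteq> []" using walk V(3) unfolding awalk_def by auto
    \<comment> \<open>A path of one arc would put \<open>(u, v)\<close> into the parent graph. With
      two arcs or more, the closing arc gives a cycle long enough for
      \<open>undirected_tree\<close>.\<close>
    have "length q \<noteq> 1"
    proof
      assume "length q = 1"
      then obtain e where "q = [e]" by (metis One_nat_def length_0_conv length_Suc_conv)
      then have "q = [(u, v)]" using q unfolding S.apath_def S.awalk_def by (cases e) auto
      then show False using q not unfolding S.apath_def S.awalk_def by auto
    qed
    then have "2 \<le> length q" using \<open>q \<noteq> []\<close> by (cases q rule: remdups_adj.cases) auto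
    then have "3 \<le> length (q @ [(v, u)])" by simp
    moreover have "cycle (q @ [(v, u)])"
    proof -
      have *: "awalk u (q @ [(v, u)]) u"
        using arcs_symmetric[OF uv] V by (intro awalk_appendI[OF walk]) (auto simp: awalk_simps)
      have "pawalk_verts u (q @ [(v, u)]) = pawalk_verts u q @ [u]"
        using awalk_verts_append[OF *] walk by simp
      moreover have "pawalk_verts u q = u # tl (pawalk_verts u q)"
        using walk by (cases q) (auto simp: awalk_def)
      ultimately have "distinct (tl (pawalk_verts u (q @ [(v, u)])))"
        using dist by (cases "pawalk_verts u q") auto
      then show ?thesis using * unfolding cycle_def by blast
    qed
    ultimately show False using T unfolding undirected_tree_def by blast
  qed
  then have "parcs T = parcs ?S" using sub by auto
  then have "T = ?S" unfolding parent_graph_def by (cases T) auto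
  then show ?thesis using root by blast
qed

lemma leaf_parent_graph:
  assumes T: "rooted V r par dep" and v: "v \<in> V"
  shows "v \<in> leaves (parent_graph V r par) \<longleftrightarrow> (\<exists>w. \<forall>u. (v, u) \<in> parcs (parent_graph V r par) \<longleftrightarrow> u = w)"
proof -
  let ?T = "parent_graph V r par"
  have "out_arcs (with_proj ?T) v = Pair v ` {u. (v, u) \<in> parcs ?T}"
    unfolding out_arcs_def by auto
  then have "out_degree (with_proj ?T) v = card {u. (v, u) \<in> parcs ?T}"
    unfolding out_degree_def by (simp add: card_image inj_on_def)
  then have "v \<in> leaves ?T \<longleftrightarrow> card {u. (v, u) \<in> parcs ?T} = 1"
    using v unfolding leaves_def by (simp add: parent_graph_def)
  also have "\<dots> \<longleftrightarrow> (\<exists>w. {u. (v, u) \<in> parcs ?T} = {w})"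
    by (auto simp: card_1_singleton_iff)
  also have "\<dots> \<longleftrightarrow> (\<exists>w. \<forall>u. (v, u) \<in> parcs ?T \<longleftrightarrow> u = w)" by blast
  finally show ?thesis .
qed

text \<open>
  A prefix-closed set \<open>P\<close> of words is a tree rooted at the empty word. Being possibly infinite, it
  can be given a ray, which keeps the root from being an uncoloured leaf.
\<close>

lemma word_tree_solvable:
  fixes H G :: "'a::infinite pair_pre_digraph" and P :: "'c list set"
  assumes small: "\<And>T :: ('a, 'a) coloured_graph. H_tree H T \<Longrightarrow> finite (leaves (underlying T)) \<Longrightarrow>
      card (leaves (underlying T)) \<le> k \<Longrightarrow> obstruction H T (self_coloured H H) \<Longrightarrow>
      obstruction H T (self_coloured H G)"
    and H: "pair_sym_digraph H" "Digraph_Component.connected (with_proj H)"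
    and HG: "parcs H \<subseteq> parcs G"
    and G: "pair_sym_digraph G" "\<And>u v. (u, v) \<in> parcs G \<Longrightarrow> side u \<noteq> (side v :: bool)"
    and P: "countable P" "\<And>w y. w @ [y] \<in> P \<Longrightarrow> w \<in> P" "c \<noteq> d" "[c] \<in> P" "[d] \<in> P"
    and W: "finite W" "card W \<le> k" "\<And>w. w \<in> W \<longleftrightarrow> w \<in> P \<and> w \<noteq> [] \<and> (\<forall>y. w @ [y] \<notin> P)"
    and lab: "\<And>w y. w @ [y] \<in> P \<Longrightarrow> (lab w, lab (w @ [y])) \<in> parcs G"
      "\<And>w. w \<in> W \<Longrightarrow> lab w \<in> pverts H"
  shows "\<exists>f. (\<forall>w\<in>P. f w \<in> pverts H) \<and> (\<forall>w y. w @ [y] \<in> P \<longrightarrow> (f w, f (w @ [y])) \<in> parcs H) \<and>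
      (\<forall>w\<in>W. f w = lab w)"
proof -
  interpret G: pair_sym_digraph G by fact
  \<comment> \<open>The trees in \<open>small\<close> have their vertices in the universe of
    \<open>H\<close>, which has room for countably many words.\<close>
  obtain \<iota> :: "nat \<Rightarrow> 'a" where "inj \<iota>" using infinite_countable_subset[OF infinite_UNIV] by blast
  define enc where "enc w = \<iota> (to_nat_on P w)" for w
  have inj: "inj_on enc P"
    using comp_inj_on[OF inj_on_to_nat_on[OF P(1)], of \<iota>] \<open>inj \<iota>\<close>
    by (simp add: enc_def[abs_def] comp_def inj_on_subset)
  define dec where "dec = inv_into P enc"
  have dec: "dec (enc w) = w" if "w \<in> P" for w unfolding dec_def using inj that by simp
  have eq: "enc w = enc w' \<longleftrightarrow> w = w'" if "w \<in> P" "w' \<in> P" for w w' using inj that by (simp add: inj_on_eq_iff)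
  define par where "par v = enc (butlast (dec v))" for v
  define r where "r = enc []"
  have nilP: "[] \<in> P" using P(2)[of "[]" c] P(4) by simp
  have butlastP: "butlast w \<in> P" if "w \<in> P" for w
    using that P(2)[of "butlast w" "last w"] nilP by (cases "w = []") auto
  have T: "rooted (enc ` P) r par (\<lambda>v. length (dec v))"
    unfolding rooted_def
  proof (intro conjI ballI)
    fix v assume "v \<in> enc ` P - {r}"
    then obtain w where w: "w \<in> P" "w \<noteq> []" "v = enc w" unfolding r_def by auto
    then show "par v \<in> enc ` P" "length (dec v) = Suc (length (dec (par v)))"
      using butlastP[OF w(1)] dec unfolding par_def by auto
  qed (use nilP r_def in auto)
  let ?T = "parent_graph (enc ` P) r par"
  have snoc: "(\<exists>y. b = a @ [y]) \<longleftrightarrow> b \<noteq> [] \<and> butlast b = a" for a b :: "'c list"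
    by (metis append_butlast_last_id snoc_eq_iff_butlast)
  have arcs: "(enc w, enc w') \<in> parcs ?T \<longleftrightarrow> (\<exists>y. w' = w @ [y] \<or> w = w' @ [y])"
    if "w \<in> P" "w' \<in> P" for w w'
  proof -
    have "(enc w, enc w') \<in> parcs ?T \<longleftrightarrow> w' \<noteq> [] \<and> butlast w' = w \<or> w \<noteq> [] \<and> butlast w = w'"
      using that nilP butlastP dec eq unfolding parent_graph_def r_def par_def by auto
    also have "\<dots> \<longleftrightarrow> (\<exists>y. w' = w @ [y] \<or> w = w' @ [y])"
      using snoc by metis
    finally show ?thesis .
  qed
  have arc_image: "\<exists>w'\<in>P. u = enc w'" if "(v, u) \<in> parcs ?T" for v u
    using that unfolding parent_graph_def by auto
  have leaf: "enc w \<in> leaves ?T \<longleftrightarrow> w \<in> W" if w: "w \<in> P" for w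
  proof
    assume "enc w \<in> leaves ?T"
    then obtain z where z: "\<And>u. (enc w, u) \<in> parcs ?T \<longleftrightarrow> u = z"
      using leaf_parent_graph[OF T, of "enc w"] w by blast
    then have uniq: "w1 = w2" if "w1 \<in> P" "w2 \<in> P" "\<exists>y. w1 = w @ [y] \<or> w = w1 @ [y]"
      "\<exists>y. w2 = w @ [y] \<or> w = w2 @ [y]" for w1 w2
      using arcs[OF w that(1)] arcs[OF w that(2)] eq[OF that(1,2)] that(3,4) by metis
    \<comment> \<open>The root has the two neighbours \<open>[c]\<close> and \<open>[d]\<close>, so
      it is no leaf.\<close>
    have "w \<noteq> []" using uniq[of "[c]" "[d]"] P(3-5) by auto
    moreover have "w @ [y] \<notin> P" for y
    proof
      assume "w @ [y] \<in> P"
      then have "w @ [y] = butlast w"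
        using append_butlast_last_id[OF \<open>w \<noteq> []\<close>] by (intro uniq butlastP[OF w]) (blast, metis+)
      then have "length (w @ [y]) = length (butlast w)" by simp
      then show False by simp
    qed
    ultimately show "w \<in> W" using W(3) w by blast
  next
    assume "w \<in> W"
    then have w': "w \<noteq> []" "\<And>y. w @ [y] \<notin> P" using W(3) by blast+
    have "(enc w, u) \<in> parcs ?T \<longleftrightarrow> u = enc (butlast w)" for u
    proof
      assume u: "(enc w, u) \<in> parcs ?T"
      then obtain w'' where w'': "w'' \<in> P" "u = enc w''" using arc_image by blast
      then show "u = enc (butlast w)" using arcs[OF w w''(1)] u w' by auto
    next
      assume "u = enc (butlast w)"
      then show "(enc w, u) \<in> parcs ?T"
        using arcs[OF w butlastP[OF w]] w'(1) by (metis append_butlast_last_id)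
    qed
    then show "enc w \<in> leaves ?T" using leaf_parent_graph[OF T, of "enc w"] w by blast
  qed
  have leaves_T: "leaves ?T = enc ` W"
    using leaf W(3) by (auto simp: leaves_def parent_graph_def)
  define col where "col h = enc ` {w \<in> W. lab w = h}" for h
  define X where "X = \<lparr> underlying = ?T, colour = col \<rparr>"
  have hom: "(lab (dec v), lab (dec u)) \<in> parcs G" if vu: "(v, u) \<in> parcs ?T" for v u
  proof -
    have "v \<in> enc ` P" "u \<in> enc ` P" using vu unfolding parent_graph_def by auto
    then obtain w w' where w: "w \<in> P" "w' \<in> P" "v = enc w" "u = enc w'" by blast
    then obtain y where "w' = w @ [y] \<or> w = w' @ [y]" using arcs[OF w(1,2)] vu[unfolded w(3,4)] by blast
    then show ?thesis using w dec lab(1) G.arcs_symmetric by metis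
  qed
  \<comment> \<open>The labels change sides along every arc of the tree, because they map it to the
    bipartite \<open>G\<close>; together with \<open>dist_H\<close> this gives the parity
    condition.\<close>
  have dist_T: "even (graph_dist ?T u v) \<longleftrightarrow> side (lab (dec u)) = side (lab (dec v))"
    if "u \<in> enc ` P" "v \<in> enc ` P" for u v
  proof (rule graph_dist_side)
    show "pair_wf_digraph ?T" using parent_graph_bidirected[OF T]
      by (simp add: pair_bidirected_digraph_def pair_sym_digraph_def)
    show "(u, v) \<in> (parcs ?T)\<^sup>*" by (rule parent_graph_rtrancl[OF T that])
  qed (use G(2) hom that in \<open>auto simp: parent_graph_def\<close>)
  have dist_H: "even (graph_dist H a b) \<longleftrightarrow> side a = side b" if "a \<in> pverts H" "b \<in> pverts H" for a b
    using H(1) connected_rtrancl(2)[OF H that] that G(2) HG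
    by (intro graph_dist_side) (auto simp: pair_sym_digraph_def)
  have WP: "W \<subseteq> P" using W(3) by auto
  have "H_tree H X"
    unfolding H_tree_def
  proof (intro conjI ballI)
    show "H_coloured H X"
      unfolding H_coloured_def X_def col_def using parent_graph_bidirected[OF T] WP
      by (auto simp: pair_bidirected_digraph_def parent_graph_def)
    show "undirected_tree (underlying X)" unfolding X_def using undirected_tree_parent_graph[OF T] by simp
    show "(\<Union>h\<in>pverts H. colour X h) = leaves (underlying X)"
      unfolding X_def col_def using leaves_T lab(2) by auto
    show "\<exists>!h. h \<in> pverts H \<and> v \<in> colour X h" if v: "v \<in> leaves (underlying X)" for v
    proof -
      obtain w where w: "w \<in> W" "v = enc w" using v leaves_T unfolding X_def by auto
      then have "v \<in> col h \<longleftrightarrow> lab w = h" for h unfolding col_def using eq WP by auto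
      then show ?thesis unfolding X_def using lab(2)[OF w(1)] by auto
    qed
    show "graph_dist (underlying X) u v mod 2 = graph_dist H a b mod 2"
      if ab: "a \<in> pverts H" "b \<in> pverts H" and uv: "u \<in> colour X a" "v \<in> colour X b" for a b u v
    proof -
      obtain w w' where w: "w \<in> W" "w' \<in> W" "u = enc w" "v = enc w'" "lab w = a" "lab w' = b"
        using uv unfolding X_def col_def by auto
      then have "w \<in> P" "w' \<in> P" using WP by auto
      then have "even (graph_dist ?T u v) \<longleftrightarrow> even (graph_dist H a b)"
        using dist_T[of u v] dist_H[OF ab] dec w by auto
      then show ?thesis unfolding X_def by (simp add: parity_cases mod2_eq_if)
    qed
  qed
  moreover have "finite (leaves (underlying X))" "card (leaves (underlying X)) \<le> k"
    unfolding X_def using leaves_T W(1,2) inj WP by (auto simp: card_image inj_on_subset)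
  moreover have "coloured_hom H X (self_coloured H G) (\<lambda>v. lab (dec v))"
    unfolding coloured_hom_def graph_hom_def X_def self_coloured_def col_def
  proof (simp, intro conjI ballI allI)
    show "lab (dec v) \<in> pverts G" if "v \<in> pverts ?T" for v
    proof -
      obtain w where w: "w \<in> P" "v = enc w" using \<open>v \<in> pverts ?T\<close> unfolding parent_graph_def by auto
      show ?thesis
      proof (cases "w = []")
        case True
        then show ?thesis using lab(1)[of "[]" c] P(4) w dec G.in_arcsD1 by simp
      next
        case False
        then have "w = butlast w @ [last w]" by simp
        then show ?thesis using lab(1)[of "butlast w" "last w"] w dec G.in_arcsD2 by metis
      qed
    qed
  qed (use hom dec WP in auto)
  ultimately have "\<not> obstruction H X (self_coloured H H)" using small unfolding obstruction_def by blast
  then obtain F where F: "coloured_hom H X (self_coloured H H) F" unfolding obstruction_def by blast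
  have "F (enc w) \<in> pverts H" if "w \<in> P" for w
    using F that unfolding coloured_hom_def graph_hom_def X_def self_coloured_def by (auto simp: parent_graph_def)
  moreover have "(F (enc w), F (enc (w @ [y]))) \<in> parcs H" if "w @ [y] \<in> P" for w y
    using F arcs[of w "w @ [y]"] that P(2)[OF that]
    unfolding coloured_hom_def graph_hom_def X_def self_coloured_def by auto
  moreover have "F (enc w) = lab w" if "w \<in> W" for w
    using F that lab(2)[OF that] unfolding coloured_hom_def X_def self_coloured_def col_def by auto
  ultimately show ?thesis by (intro exI[of _ "\<lambda>w. F (enc w)"]) blast
qed

subsection \<open>Compactness\<close>

text \<open>By Tychonoff the assignments form a compact space, and a constraint on two coordinates
  is closed: its complement is a union of open cylinders. So the finite intersection property
  applies.\<close>

lemma binary_constraints_compact: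
  fixes V :: "'v set" and B :: "'b set"
  assumes "finite B"
    and fin: "\<And>S. finite S \<Longrightarrow> S \<subseteq> V \<Longrightarrow> \<exists>r. (\<forall>v\<in>S. r v \<in> B) \<and> (\<forall>u\<in>S. \<forall>v\<in>S. Q u v (r u) (r v))"
  shows "\<exists>r. (\<forall>v\<in>V. r v \<in> B) \<and> (\<forall>u\<in>V. \<forall>v\<in>V. Q u v (r u) (r v))"
proof -
  define X where "X = product_topology (\<lambda>_. discrete_topology B) V"
  define K where "K u v = {r \<in> topspace X. Q u v (r u) (r v)}" for u v
  have space: "topspace X = V \<rightarrow>\<^sub>E B" unfolding X_def by simp
  have compact: "compact_space X"
    unfolding X_def compact_space_product_topology using assms(1)
    by (simp add: compact_space_discrete_topology)
  have cyl: "openin X {r \<in> topspace X. r v = b}" if "v \<in> V" for v b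
  proof -
    have "continuous_map X (discrete_topology B) (\<lambda>r. r v)"
      unfolding X_def using that by (rule continuous_map_product_projection)
    then have "openin X {r \<in> topspace X. r v \<in> {b} \<inter> B}"
      by (rule openin_continuous_map_preimage) simp
    moreover have "{r \<in> topspace X. r v \<in> {b} \<inter> B} = {r \<in> topspace X. r v = b}"
      using that unfolding space by auto
    ultimately show ?thesis by simp
  qed
  have closed: "closedin X (K u v)" if uv: "u \<in> V" "v \<in> V" for u v
  proof -
    have "openin X A" if "A \<in> (\<lambda>(a, b). {r \<in> topspace X. r u = a} \<inter> {r \<in> topspace X. r v = b}) ` {(a, b). \<not> Q u v a b}" for A
      using that cyl[OF uv(1)] cyl[OF uv(2)] by (auto intro: openin_Int)
    from openin_Union[OF this] have "openin X (topspace X - K u v)"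
      by (rule back_subst[of "openin X"]) (auto simp: K_def)
    then show ?thesis unfolding closedin_def K_def by auto
  qed
  \<comment> \<open>The whole space is added so that points of the intersection are assignments even
    when \<open>V\<close> is empty.\<close>
  define \<C> where "\<C> = insert (topspace X) ((\<lambda>(u, v). K u v) ` (V \<times> V))"
  have "\<Inter> \<F> \<noteq> {}" if F: "finite \<F>" "\<F> \<subseteq> \<C>" for \<F>
  proof -
    have "finite (\<F> - {topspace X})" "\<F> - {topspace X} \<subseteq> (\<lambda>(u, v). K u v) ` (V \<times> V)"
      using F unfolding \<C>_def by auto
    from finite_subset_image[OF this] obtain S
      where S: "finite S" "S \<subseteq> V \<times> V" "\<F> - {topspace X} = (\<lambda>(u, v). K u v) ` S" by metis
    define S' where "S' = fst ` S \<union> snd ` S"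
    have S': "finite S'" "S' \<subseteq> V" unfolding S'_def using S by auto
    from fin[OF this] obtain r where r: "\<forall>v\<in>S'. r v \<in> B" "\<forall>u\<in>S'. \<forall>v\<in>S'. Q u v (r u) (r v)" by blast
    have "\<exists>b. b \<in> B" if "v \<in> V" for v using fin[of "{v}"] that by auto
    then obtain b where b: "\<And>v. v \<in> V \<Longrightarrow> b \<in> B" by metis
    define r' where "r' v = (if v \<in> S' then r v else if v \<in> V then b else undefined)" for v
    have r'_top: "r' \<in> topspace X"
      unfolding space
    proof (rule PiE_I)
      show "r' v \<in> B" if "v \<in> V" for v using r(1) b[OF that] that unfolding r'_def by simp
      show "r' v = undefined" if "v \<notin> V" for v using that S'(2) unfolding r'_def by auto
    qed
    have r'_K: "r' \<in> K u v" if "(u, v) \<in> S" for u v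
    proof -
      have "u \<in> S'" "v \<in> S'" using that unfolding S'_def by force+
      then show ?thesis using r(2) r'_top unfolding K_def r'_def by simp
    qed
    have "r' \<in> C" if "C \<in> \<F>" for C
    proof (cases "C = topspace X")
      case False
      then have "C \<in> \<F> - {topspace X}" using that by blast
      then show ?thesis unfolding S(3) using r'_K by auto
    qed (use r'_top in simp)
    then show ?thesis by blast
  qed
  moreover have "\<forall>C\<in>\<C>. closedin X C" unfolding \<C>_def using closed by auto
  ultimately have "\<Inter> \<C> \<noteq> {}" using compact unfolding compact_space_fip by (elim allE[of _ \<C>]) blast
  then obtain r where "r \<in> \<Inter> \<C>" by blast
  then have "r \<in> V \<rightarrow>\<^sub>E B" "\<And>u v. u \<in> V \<Longrightarrow> v \<in> V \<Longrightarrow> r \<in> K u v" unfolding \<C>_def space[symmetric] by auto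
  then have "\<And>v. v \<in> V \<Longrightarrow> r v \<in> B" "\<And>u v. u \<in> V \<Longrightarrow> v \<in> V \<Longrightarrow> Q u v (r u) (r v)"
    unfolding K_def by auto
  then show ?thesis by (intro exI[of _ r]) blast
qed

subsection \<open>Retractions from near-unanimity\<close>

text \<open>The prefixes of walks in \<open>W\<close>, marked by \<open>Some\<close>, together with
  a ray of words over \<open>None\<close> form a word tree to which \<open>tree\<close> applies. Its
  solution is read back on the prefixes and then extended to all walks.\<close>

lemma (in nu_extension) few_walks_solvable:
  assumes g: "g \<in> VG" "g \<notin> VH" and W: "finite W" "card W \<le> k"
    and walks: "\<And>w. w \<in> W \<Longrightarrow> walk stop_arcs g w \<and> last (g # w) \<in> VH" and "VH \<noteq> {}"
    and tree: "\<And>(P :: 'a option list set) W lab c d.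
      countable P \<Longrightarrow> (\<And>w y. w @ [y] \<in> P \<Longrightarrow> w \<in> P) \<Longrightarrow> c \<noteq> d \<Longrightarrow> [c] \<in> P \<Longrightarrow> [d] \<in> P \<Longrightarrow>
      finite W \<Longrightarrow> card W \<le> k \<Longrightarrow> (\<And>w. w \<in> W \<longleftrightarrow> w \<in> P \<and> w \<noteq> [] \<and> (\<forall>y. w @ [y] \<notin> P)) \<Longrightarrow>
      (\<And>w y. w @ [y] \<in> P \<Longrightarrow> (lab w, lab (w @ [y])) \<in> EG) \<Longrightarrow> (\<And>w. w \<in> W \<Longrightarrow> lab w \<in> VH) \<Longrightarrow>
      \<exists>f. (\<forall>w\<in>P. f w \<in> VH) \<and> (\<forall>w y. w @ [y] \<in> P \<longrightarrow> (f w, f (w @ [y])) \<in> E) \<and> (\<forall>w\<in>W. f w = lab w)"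
  shows "\<exists>f\<in>treehom stop_arcs id g. \<forall>w\<in>W. f w = last (g # w)"
proof (cases "W = {}")
  case True
  obtain a where "a \<in> VH" using \<open>VH \<noteq> {}\<close> by blast
  then have "\<exists>b\<in>VH. side b = side g"
    using nbr[of a] E_side[of a "nbr a"] E_VH[of a "nbr a"] by (cases "side a = side g") auto
  then show ?thesis using treehom_exists[of stop_arcs id _ g, OF stop_arcs_side] True by fastforce
next
  case False
  then obtain w0 where w0: "w0 \<in> W" by blast
  have ne: "w \<noteq> []" if "w \<in> W" for w using walks[OF that] g by auto
  define g1 where "g1 = hd w0"
  have w0_eq: "w0 = g1 # tl w0" unfolding g1_def using ne[OF w0] by simp
  then have gg1: "(g, g1) \<in> EG" using walks[OF w0] unfolding stop_arcs_def by (metis (no_types, lifting) case_prodD mem_Collect_eq walk.simps(2))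
  define P0 where "P0 = {p. \<exists>q. p @ q \<in> W}"
  have P0_snoc: "p \<in> P0" if "p @ [y] \<in> P0" for p y using that unfolding P0_def by auto
  have P0_arc: "(last (g # p), y) \<in> stop_arcs" if py: "p @ [y] \<in> P0" for p y
  proof -
    obtain q where "p @ [y] @ q \<in> W" using py unfolding P0_def by auto
    from walks[OF this] show ?thesis by (simp add: walk_append split: if_splits)
  qed
  have W_P0: "W \<subseteq> P0" unfolding P0_def by (auto intro: exI[of _ "[]"])
  define P :: "'a option list set" where "P = map Some ` P0 \<union> range (\<lambda>n. replicate n None)"
  \<comment> \<open>The ray is labelled by going back and forth along the arc from \<open>g\<close>
    to \<open>g1\<close>.\<close>
  define lab where "lab w = (if w = replicate (length w) None then (if even (length w) then g else g1)
    else last (g # map the w))" for w :: "'a option list"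
  have lab_map: "lab (map Some p) = last (g # p)" for p
  proof (cases p)
    case (Cons y p')
    then have "map Some p \<noteq> replicate (length (map Some p)) None" by simp
    then show ?thesis unfolding lab_def by (simp add: comp_def)
  qed (simp add: lab_def)
  have lab_rep: "lab (replicate n None) = (if even n then g else g1)" for n
    unfolding lab_def by simp
  have P_snoc: "(\<exists>p z. w = map Some p \<and> y = Some z \<and> p @ [z] \<in> P0) \<or> (\<exists>n. w = replicate n None \<and> y = None)"
    if "w @ [y] \<in> P" for w y
    using that unfolding P_def
  proof
    assume "w @ [y] \<in> map Some ` P0"
    then obtain p where p: "p \<in> P0" "map Some p = w @ [y]" by force
    then have "p = butlast p @ [last p]" "map Some (butlast p) = w" "y = Some (last p)"
      by (metis Nil_is_append_conv append_butlast_last_id list.discI list.map_disc_iff,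
          metis butlast_snoc map_butlast, metis last_map last_snoc list.map_disc_iff snoc_eq_iff_butlast)
    then show ?thesis using p(1) by metis
  next
    assume "w @ [y] \<in> range (\<lambda>n. replicate n None)"
    then obtain n where n: "w @ [y] = replicate n None" by blast
    then have "\<forall>x\<in>set (w @ [y]). x = None" by simp
    then have "w = replicate (length w) None \<and> y = None" by (simp add: replicate_length_same)
    then show ?thesis by blast
  qed
  have repP: "replicate n None \<in> P" for n unfolding P_def by blast
  have mapP: "map Some p \<in> P" if "p \<in> P0" for p unfolding P_def using that by blast
  have "P0 \<subseteq> (\<Union>w\<in>W. range (\<lambda>i. take i w))"
  proof
    fix p assume "p \<in> P0"
    then obtain q where "p @ q \<in> W" unfolding P0_def by blast
    moreover have "p = take (length p) (p @ q)" by simp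
    ultimately show "p \<in> (\<Union>w\<in>W. range (\<lambda>i. take i w))" by blast
  qed
  then have "countable P0" by (rule countable_subset) (simp add: countable_finite[OF W(1)])
  then have "countable P" unfolding P_def by simp
  \<comment> \<open>A walk of \<open>W\<close> cannot be continued, as \<open>stop_arcs\<close> has
    no arc leaving \<open>H\<close>; the ray never ends.\<close>
  have Wleaf: "w \<in> map Some ` W \<longleftrightarrow> w \<in> P \<and> w \<noteq> [] \<and> (\<forall>y. w @ [y] \<notin> P)" for w
  proof
    assume "w \<in> map Some ` W"
    then obtain w1 where w1: "w1 \<in> W" "w = map Some w1" by blast
    have "w @ [y] \<notin> P" for y
    proof
      assume "w @ [y] \<in> P"
      from P_snoc[OF this] ne[OF w1(1)] w1(2) obtain z where "w1 @ [z] \<in> P0"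
        by (auto simp: map_eq_conv inj_map_eq_map) (cases w1; auto simp: Cons_replicate_eq)
      from P0_arc[OF this] walks[OF w1(1)] show False unfolding stop_arcs_def by simp
    qed
    then show "w \<in> P \<and> w \<noteq> [] \<and> (\<forall>y. w @ [y] \<notin> P)" using w1 W_P0 mapP ne by auto
  next
    assume w: "w \<in> P \<and> w \<noteq> [] \<and> (\<forall>y. w @ [y] \<notin> P)"
    have "w \<noteq> replicate n None" for n
      using w repP[of "Suc n"] by (metis replicate_append_same replicate_Suc)
    then obtain p where p: "p \<in> P0" "w = map Some p" using w unfolding P_def by auto
    then obtain q where q: "p @ q \<in> W" unfolding P0_def by blast
    have "q = []"
    proof (cases q)
      case (Cons y q')
      then have "p @ [y] \<in> P0" using q unfolding P0_def by auto
      from mapP[OF this] show ?thesis using w p by simp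
    qed
    then show "w \<in> map Some ` W" using p q by simp
  qed
  have "\<exists>f. (\<forall>w\<in>P. f w \<in> VH) \<and> (\<forall>w y. w @ [y] \<in> P \<longrightarrow> (f w, f (w @ [y])) \<in> E) \<and>
      (\<forall>w\<in>map Some ` W. f w = lab w)"
  proof (rule tree[OF \<open>countable P\<close> _ _ _ _ _ _ Wleaf])
    show "w \<in> P" if "w @ [y] \<in> P" for w y
      using P_snoc[OF that] P0_snoc mapP repP by auto
    show "None \<noteq> Some g1" by simp
    show "[None] \<in> P" using repP[of 1] by simp
    have "[g1] @ tl w0 \<in> W" using w0 w0_eq by simp
    then have "[g1] \<in> P0" unfolding P0_def by blast
    from mapP[OF this] show "[Some g1] \<in> P" by simp
    show "finite (map Some ` W)" "card (map Some ` W) \<le> k"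
      using W card_image_le[OF W(1), of "map Some"] by auto
    show "(lab w, lab (w @ [y])) \<in> EG" if "w @ [y] \<in> P" for w y
      using P_snoc[OF that]
    proof (elim disjE exE conjE)
      fix p z assume p: "w = map Some p" "y = Some z" "p @ [z] \<in> P0"
      have "w @ [y] = map Some (p @ [z])" using p by simp
      then have "lab (w @ [y]) = z" by (metis lab_map last_ConsR last_snoc snoc_eq_iff_butlast)
      then show ?thesis using P0_arc[OF p(3)] lab_map[of p] p(1) unfolding stop_arcs_def by simp
    next
      fix n assume "w = replicate n None" "y = None"
      then have "lab w = (if even n then g else g1)" "lab (w @ [y]) = (if even (Suc n) then g else g1)"
        using lab_rep[of n] lab_rep[of "Suc n"] by (auto simp: replicate_append_same)
      then show ?thesis using gg1 EG_sym by simp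
    qed
    show "lab w \<in> VH" if "w \<in> map Some ` W" for w using that walks lab_map by auto
  qed
  then obtain f where f: "\<And>w. w \<in> P \<Longrightarrow> f w \<in> VH" "\<And>w y. w @ [y] \<in> P \<Longrightarrow> (f w, f (w @ [y])) \<in> E"
    "\<And>w. w \<in> W \<Longrightarrow> f (map Some w) = last (g # w)"
    using lab_map by (metis imageI)
  define f0 where "f0 p = f (map Some p)" for p
  have f0: "(f0 p, f0 (p @ [y])) \<in> E" if "p @ [y] \<in> P0" for p y
    using f(2)[of "map Some p" "Some y"] mapP[OF that] unfolding f0_def by simp
  \<comment> \<open>The solution comes without information on sides. Whether it agrees in side with
    the labels is constant along arcs, and at the end of \<open>w0\<close> it does.\<close>
  have inv: "(side (f0 p) = side (last (g # p))) = (side (f0 []) = side g)" if "p \<in> P0" for p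
    using that
  proof (induction p rule: rev_induct)
    case (snoc y p)
    then show ?case using P0_snoc[OF snoc.prems] E_side[OF f0[OF snoc.prems]]
        stop_arcs_side[OF P0_arc[OF snoc.prems]] by auto
  qed simp
  have "f0 w0 = last (g # w0)" unfolding f0_def by (rule f(3)[OF w0])
  then have side0: "side (f0 []) = side g" using inv[of w0] w0 W_P0 by auto
  have nil: "[] \<in> P0" unfolding P0_def using w0 by auto
  have "\<exists>f'\<in>treehom stop_arcs id g. \<forall>w\<in>P0. f' w = f0 w"
    using nil side0 f0 P0_snoc f(1)[OF mapP[OF nil]]
    by (intro treehom_extend[OF stop_arcs_side]) (auto simp: f0_def)
  then obtain f' where f': "f' \<in> treehom stop_arcs id g" "\<forall>w\<in>P0. f' w = f0 w" by blast
  have "f' w = last (g # w)" if "w \<in> W" for w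
    using f'(2) W_P0 f(3)[OF that] that unfolding f0_def by auto
  then show ?thesis using f'(1) by blast
qed

lemma bipartite_side:
  assumes "bipartite_graph G"
  shows "\<exists>side :: 'a \<Rightarrow> bool. \<forall>u v. (u, v) \<in> parcs G \<longrightarrow> side u \<noteq> side v"
proof -
  obtain A B where "A \<inter> B = {}" "parcs G \<subseteq> A \<times> B \<union> B \<times> A"
    using assms unfolding bipartite_graph_def by blast
  then have "\<forall>u v. (u, v) \<in> parcs G \<longrightarrow> (u \<in> A) \<noteq> (v \<in> A)" by blast
  then show ?thesis by (rule exI[of _ "\<lambda>x. x \<in> A"])
qed

lemma nu_polymorphismD:
  assumes "nu_polymorphism H (k + 1) f"
  shows "\<lbrakk>length xs = k + 1; length ys = k + 1; \<And>i. i \<le> k \<Longrightarrow> (xs ! i, ys ! i) \<in> parcs H;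
      pair_wf_digraph H\<rbrakk> \<Longrightarrow> (f xs, f ys) \<in> parcs H"
    and "\<lbrakk>length xs = k + 1; set xs \<subseteq> pverts H; c \<in> pverts H; i \<le> k;
      \<And>j. j \<le> k \<Longrightarrow> j \<noteq> i \<Longrightarrow> xs ! j = c\<rbrakk> \<Longrightarrow> f xs = c"
proof -
  assume xs: "length xs = k + 1" "length ys = k + 1" "\<And>i. i \<le> k \<Longrightarrow> (xs ! i, ys ! i) \<in> parcs H"
    and wf: "pair_wf_digraph H"
  have "set xs \<subseteq> pverts H" "set ys \<subseteq> pverts H"
    using xs(1,2) pair_wf_digraph.in_arcsD1[OF wf xs(3)] pair_wf_digraph.in_arcsD2[OF wf xs(3)]
    by (auto simp: in_set_conv_nth less_Suc_eq_le)
  then have "(xs, ys) \<in> parcs (graph_power H (k + 1))"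
    using xs unfolding graph_power_def by (auto simp: Let_def less_Suc_eq_le)
  then show "(f xs, f ys) \<in> parcs H" using assms unfolding nu_polymorphism_def graph_hom_def by blast
next
  assume xs: "length xs = k + 1" "set xs \<subseteq> pverts H" "c \<in> pverts H" "i \<le> k"
    "\<And>j. j \<le> k \<Longrightarrow> j \<noteq> i \<Longrightarrow> xs ! j = c"
  have "xs = (replicate (k + 1) c)[i := xs ! i]"
    by (rule nth_equalityI)
      (use xs in \<open>auto simp: nth_list_update less_Suc_eq_le simp del: replicate_Suc\<close>)
  moreover have "xs ! i \<in> pverts H" using xs by (auto simp: subset_iff)
  ultimately show "f xs = c" using assms xs(3,4) unfolding nu_polymorphism_def
    by (metis less_Suc_eq_le Suc_eq_plus1)
qed

text \<open>A connected \<open>H\<close> without arcs is a single vertex, for which long walks do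
  not exist, and is treated separately. Otherwise compactness reduces the claim to finite sets
  \<open>S\<close>, each enlarged by \<open>H\<close>.\<close>

lemma retract_if_nu:
  fixes H G :: "'a::infinite pair_pre_digraph"
  assumes small: "\<And>T :: ('a, 'a) coloured_graph. H_tree H T \<Longrightarrow> finite (leaves (underlying T)) \<Longrightarrow>
      card (leaves (underlying T)) \<le> k \<Longrightarrow> obstruction H T (self_coloured H H) \<Longrightarrow>
      obstruction H T (self_coloured H G)"
    and H: "pair_sym_digraph H" "Digraph_Component.connected (with_proj H)" "finite (pverts H)"
    and G: "bipartite_graph G" and HG: "induced_subgraph (with_proj H) (with_proj G)"
    and k: "2 \<le> k" and m: "nu_polymorphism H (k + 1) m"
  shows "is_retract H G"
proof -
  have sub: "pverts H \<subseteq> pverts G" "parcs H = {e \<in> parcs G. fst e \<in> pverts H \<and> snd e \<in> pverts H}"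
    using HG unfolding induced_subgraph_def subgraph_def by simp_all
  have arcs: "parcs H \<subseteq> parcs G" unfolding sub(2) by blast
  have "pair_sym_digraph G" using G unfolding bipartite_graph_def by (rule conjunct1)
  then interpret G: pair_sym_digraph G .
  interpret H: pair_sym_digraph H by fact
  obtain side :: "'a \<Rightarrow> bool" where side: "\<And>u v. (u, v) \<in> parcs G \<Longrightarrow> side u \<noteq> side v"
    using bipartite_side[OF G] by blast
  note conn = connected_rtrancl[OF H(1,2)]
  note tree = word_tree_solvable[OF small H(1,2) arcs G.pair_sym_digraph_axioms side]
  show ?thesis
  proof (cases "parcs H = {}")
    case True
    \<comment> \<open>A double ray has no leaves, so it is an obstruction to \<open>H\<close> but not to a graph with an arc.\<close>
    have "parcs G = {}"
    proof (rule ccontr)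
      assume "parcs G \<noteq> {}"
      then obtain u v where uv: "(u, v) \<in> parcs G" by auto
      define P where "P = range (\<lambda>n. replicate n True) \<union> range (\<lambda>n. replicate n False)"
      have repP: "replicate n b \<in> P" for n b unfolding P_def by (cases b) auto
      have P: "w @ [y] \<in> P \<Longrightarrow> w \<in> P" for w y
      proof -
        assume "w @ [y] \<in> P"
        then obtain n b where "w @ [y] = replicate n b" unfolding P_def by auto
        then have "\<forall>x\<in>set (w @ [y]). x = b" by simp
        then have "w = replicate (length w) b" by (simp add: replicate_length_same)
        then show "w \<in> P" using repP by metis
      qed
      have P': "\<exists>y. w @ [y] \<in> P" if "w \<in> P" for w
      proof -
        obtain n b where "w = replicate n b" using \<open>w \<in> P\<close> unfolding P_def by auto
        then have "w @ [b] = replicate (Suc n) b" by (simp add: replicate_append_same)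
        then show ?thesis using repP by metis
      qed
      define lab where "lab w = (if even (length w) then u else v)" for w :: "bool list"
      have one: "[True] = replicate 1 True" "[False] = replicate 1 False" by auto
      have "\<exists>f. (\<forall>w\<in>P. f w \<in> pverts H) \<and> (\<forall>w y. w @ [y] \<in> P \<longrightarrow> (f w, f (w @ [y])) \<in> parcs H) \<and>
          (\<forall>w\<in>{}. f w = lab w)"
      proof (rule tree)
        show "countable P" unfolding P_def by simp
        show "True \<noteq> False" by simp
        show "[True] \<in> P" "[False] \<in> P" unfolding one by (rule repP)+
        show "(lab w, lab (w @ [y])) \<in> parcs G" for w y
          unfolding lab_def using uv G.arcs_symmetric[OF uv] by simp
      qed (use P P' in auto)
      moreover have "[True] \<in> P" unfolding one by (rule repP)
      ultimately show False using True by (metis append_Nil empty_iff)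
    qed
    moreover obtain h where h: "h \<in> pverts H" using conn(1) by blast
    ultimately have "graph_hom G H (\<lambda>_. h)" unfolding graph_hom_def by simp
    moreover have "h = v" if "v \<in> pverts H" for v using conn(2)[OF h that] True by simp
    ultimately show ?thesis unfolding is_retract_def by (intro exI[of _ "\<lambda>_. h"]) blast
  next
    case False
    then obtain c d where cd: "(c, d) \<in> parcs H" by auto
    have "\<exists>\<delta>. \<forall>n\<ge>\<delta>. \<forall>a\<in>pverts H. \<forall>b\<in>pverts H. (side a = side b \<longleftrightarrow> even n) \<longrightarrow> (a, b) \<in> parcs H ^^ n"
    proof (rule uniform_walk_length[OF H(3) _ _ conn(2) cd H.in_arcsD1[OF cd]])
      show "(b, a) \<in> parcs H" if "(a, b) \<in> parcs H" for a b using H.arcs_symmetric[OF that] .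
      show "side a \<noteq> side b" if "(a, b) \<in> parcs H" for a b using side[OF subsetD[OF arcs that]] .
    qed
    then obtain \<delta> where \<delta>: "\<And>n a b. \<delta> \<le> n \<Longrightarrow> a \<in> pverts H \<Longrightarrow> b \<in> pverts H \<Longrightarrow>
        (side a = side b \<longleftrightarrow> even n) \<Longrightarrow> (a, b) \<in> parcs H ^^ n" by blast
    have "\<exists>r. (\<forall>v\<in>pverts G. r v \<in> pverts H) \<and> (\<forall>u\<in>pverts G. \<forall>v\<in>pverts G.
        ((u, v) \<in> parcs G \<longrightarrow> (r u, r v) \<in> parcs H) \<and> (u \<in> pverts H \<longrightarrow> r u = u))"
    proof (rule binary_constraints_compact[OF H(3)])
      fix S assume S: "finite S" "S \<subseteq> pverts G"
      define VG where "VG = S \<union> pverts H"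
      define EG where "EG = parcs G \<inter> VG \<times> VG"
      interpret nu_extension "pverts H" "parcs H" side \<delta> m k VG EG
      proof
        show "finite (pverts H)" by fact
        show "a \<in> pverts H \<and> b \<in> pverts H" if "(a, b) \<in> parcs H" for a b
          using that H.in_arcsD1 H.in_arcsD2 by blast
        show "(m xs, m ys) \<in> parcs H" if "length xs = k + 1" "length ys = k + 1"
          "\<And>i. i \<le> k \<Longrightarrow> (xs ! i, ys ! i) \<in> parcs H" for xs ys
          using nu_polymorphismD(1)[OF m that H.pair_wf_digraph_axioms] .
        show "m xs = c" if "length xs = k + 1" "set xs \<subseteq> pverts H" "c \<in> pverts H" "i \<le> k"
          "\<And>j. j \<le> k \<Longrightarrow> j \<noteq> i \<Longrightarrow> xs ! j = c" for xs c i
          using nu_polymorphismD(2)[OF m that] .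
        show "(b, a) \<in> parcs H" if "(a, b) \<in> parcs H" for a b using H.arcs_symmetric[OF that] .
        show "side a \<noteq> side b" if "(a, b) \<in> parcs H" for a b using side[OF subsetD[OF arcs that]] .
        show "(a, b) \<in> parcs H ^^ n" if "\<delta> \<le> n" "a \<in> pverts H" "b \<in> pverts H" "side a = side b \<longleftrightarrow> even n"
          for a b n using \<delta>[OF that] .
        show "finite VG" unfolding VG_def using S(1) H(3) by simp
        show "EG \<subseteq> VG \<times> VG" unfolding EG_def by blast
        show "(v, u) \<in> EG" if "(u, v) \<in> EG" for u v
          using that G.arcs_symmetric[of u v] unfolding EG_def by blast
        show "side u \<noteq> side v" if "(u, v) \<in> EG" for u v using that side unfolding EG_def by blast
        show "pverts H \<subseteq> VG" unfolding VG_def by blast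
        show "(u, v) \<in> parcs H" if "u \<in> pverts H" "v \<in> pverts H" "(u, v) \<in> EG" for u v
          using that unfolding sub(2) EG_def by simp
      qed (rule k)
      have "\<exists>r. (\<forall>g\<in>VG. r g \<in> pverts H) \<and> (\<forall>(u, v)\<in>EG. (r u, r v) \<in> parcs H) \<and> (\<forall>h\<in>pverts H. r h = h)"
      proof (rule finite_retraction)
        fix g W
        assume gW: "g \<in> VG - pverts H" "finite W" "card W \<le> k"
          "\<forall>w\<in>W. walk stop_arcs g w \<and> last (g # w) \<in> pverts H"
        show "\<exists>f\<in>treehom stop_arcs id g. \<forall>w\<in>W. f w = last (g # w)"
        proof (rule few_walks_solvable)
          show "\<exists>f. (\<forall>w\<in>P. f w \<in> pverts H) \<and> (\<forall>w y. w @ [y] \<in> P \<longrightarrow> (f w, f (w @ [y])) \<in> parcs H) \<and>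
              (\<forall>w\<in>W. f w = lab w)"
            if "countable P" "\<And>w y. w @ [y] \<in> P \<Longrightarrow> w \<in> P" "c \<noteq> d" "[c] \<in> P" "[d] \<in> P"
              "finite W" "card W \<le> k" "\<And>w. w \<in> W \<longleftrightarrow> w \<in> P \<and> w \<noteq> [] \<and> (\<forall>y. w @ [y] \<notin> P)"
              "\<And>w y. w @ [y] \<in> P \<Longrightarrow> (lab w, lab (w @ [y])) \<in> EG" "\<And>w. w \<in> W \<Longrightarrow> lab w \<in> pverts H"
            for P :: "'a option list set" and W lab c d
          proof (rule tree)
            show "countable P" "c \<noteq> d" "[c] \<in> P" "[d] \<in> P" "finite W" "card W \<le> k" by fact+
            show "w \<in> P" if "w @ [y] \<in> P" for w y
              using \<open>\<And>w y. w @ [y] \<in> P \<Longrightarrow> w \<in> P\<close>[OF that] .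
            show "w \<in> W \<longleftrightarrow> w \<in> P \<and> w \<noteq> [] \<and> (\<forall>y. w @ [y] \<notin> P)" for w by fact
            show "(lab w, lab (w @ [y])) \<in> parcs G" if "w @ [y] \<in> P" for w y
              using \<open>\<And>w y. w @ [y] \<in> P \<Longrightarrow> (lab w, lab (w @ [y])) \<in> EG\<close>[OF that] unfolding EG_def by blast
            show "lab w \<in> pverts H" if "w \<in> W" for w
              using \<open>\<And>w. w \<in> W \<Longrightarrow> lab w \<in> pverts H\<close>[OF that] .
          qed
        qed (use gW conn(1) in auto)
      qed
      then obtain r where r: "\<forall>g\<in>VG. r g \<in> pverts H" "\<forall>(u, v)\<in>EG. (r u, r v) \<in> parcs H"
        "\<forall>h\<in>pverts H. r h = h" by blast
      then show "\<exists>r. (\<forall>v\<in>S. r v \<in> pverts H) \<and> (\<forall>u\<in>S. \<forall>v\<in>S.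
          ((u, v) \<in> parcs G \<longrightarrow> (r u, r v) \<in> parcs H) \<and> (u \<in> pverts H \<longrightarrow> r u = u))"
        by (intro exI[of _ r]) (auto simp: VG_def EG_def)
    qed
    then obtain r where r: "\<forall>v\<in>pverts G. r v \<in> pverts H" "\<forall>u\<in>pverts G. \<forall>v\<in>pverts G.
        ((u, v) \<in> parcs G \<longrightarrow> (r u, r v) \<in> parcs H) \<and> (u \<in> pverts H \<longrightarrow> r u = u)" by blast
    then have "graph_hom G H r" unfolding graph_hom_def using G.in_arcsD1 G.in_arcsD2 by blast
    moreover have "\<forall>h\<in>pverts H. r h = h" using r sub by blast
    ultimately show ?thesis unfolding is_retract_def by blast
  qed
qed

subsection \<open>Projecting trees\<close>

text \<open>The value at \<open>v\<close> is computed by recursion on the number of steps, run for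
  \<open>dep v\<close> steps; it stops at \<open>r\<close> whatever the depth of \<open>r\<close>
  is.\<close>

lemma rooted_recursion:
  assumes "rooted V r par dep"
  shows "\<exists>g. g r = c \<and> (\<forall>v\<in>V - {r}. g v = \<Phi> v (g (par v)))"
proof -
  define h where "h = rec_nat (\<lambda>_. c) (\<lambda>_ h v. if v = r then c else \<Phi> v (h (par v)))"
  have h: "h 0 v = c" "h (Suc n) v = (if v = r then c else \<Phi> v (h n (par v)))" for n v
    unfolding h_def by simp_all
  have "h (dep r) r = c" by (cases "dep r") (simp_all add: h)
  moreover have "h (dep v) v = \<Phi> v (h (dep (par v)) (par v))" if "v \<in> V - {r}" for v
    using rootedD(3)[OF assms, of v] that by (simp add: h)
  ultimately show ?thesis by (intro exI[of _ "\<lambda>v. h (dep v) v"]) blast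
qed

text \<open>
  Deleting the set \<open>D\<close> cuts the tree into pieces, each with at most \<open>k\<close> boundary arcs since there are
  at most \<open>k\<close> leaves. Each boundary arc spoils at most one of the \<open>k + 1\<close> coordinates, so on every
  piece some coordinate can be used. Branches without leaves are folded back instead.
\<close>

lemma tree_projection:
  fixes V :: "'v set" and VH :: "'a set"
  assumes T: "rooted V r par dep" and L: "finite L" "card L \<le> k" "L \<subseteq> D" "L \<subseteq> V" "L \<noteq> {} \<Longrightarrow> r \<in> L"
    and DD: "\<And>v. v \<in> V \<Longrightarrow> v \<noteq> r \<Longrightarrow> v \<in> D \<Longrightarrow> par v \<in> D \<Longrightarrow> (a v, a (par v)) \<in> E"
    and NN: "\<And>v i. v \<in> V \<Longrightarrow> v \<noteq> r \<Longrightarrow> v \<notin> D \<Longrightarrow> par v \<notin> D \<Longrightarrow> i \<le> k \<Longrightarrow> (t v i, t (par v) i) \<in> E"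
    and ND: "\<And>v. v \<in> V \<Longrightarrow> v \<noteq> r \<Longrightarrow> v \<notin> D \<Longrightarrow> par v \<in> D \<Longrightarrow>
        \<exists>i0. \<forall>i\<le>k. i \<noteq> i0 \<longrightarrow> (t v i, a (par v)) \<in> E"
    and DN: "\<And>v. v \<in> V \<Longrightarrow> v \<noteq> r \<Longrightarrow> v \<in> D \<Longrightarrow> par v \<notin> D \<Longrightarrow>
        \<exists>i0. \<forall>i\<le>k. i \<noteq> i0 \<longrightarrow> (a v, t (par v) i) \<in> E"
    and VH: "h \<in> VH" "\<And>v. v \<in> V \<Longrightarrow> v \<in> D \<Longrightarrow> a v \<in> VH" "\<And>v i. v \<in> V \<Longrightarrow> v \<notin> D \<Longrightarrow> i \<le> k \<Longrightarrow> t v i \<in> VH"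
    and nb: "\<And>b. V \<noteq> {r} \<Longrightarrow> b \<in> VH \<Longrightarrow> nb b \<in> VH \<and> (nb b, b) \<in> E"
  shows "\<exists>g. (\<forall>v\<in>V. g v \<in> VH) \<and> (\<forall>v\<in>V - {r}. (g v, g (par v)) \<in> E) \<and> (\<forall>v\<in>L. g v = a v)"
proof -
  note TD = rootedD[OF T]
  define A where "A = {(v, par v) |v. v \<in> V \<and> v \<noteq> r}"
  define B where "B = {(v, par v) |v. v \<in> V \<and> v \<noteq> r \<and> v \<notin> D \<and> par v \<notin> D}"
  \<comment> \<open>\<open>A\<close> points upwards, so a vertex is alive if an element of
    \<open>L\<close> lies at or below it. Only the branches that are not alive are folded
    back.\<close>
  define alive where "alive v \<longleftrightarrow> (\<exists>l\<in>L. (l, v) \<in> A\<^sup>*)" for v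
  have BA: "B\<^sup>* \<subseteq> A\<^sup>*" unfolding A_def B_def by (rule rtrancl_mono) blast
  have svA: "single_valued A" unfolding A_def single_valued_def by blast
  have dep_A: "dep w \<le> dep v" if "(v, w) \<in> A\<^sup>*" for v w
    using that by induction (use TD(3) in \<open>force simp: A_def\<close>)+
  have A_V: "w \<in> V" if "(v, w) \<in> A\<^sup>*" "v \<in> V" for v w
    using that by induction (use TD(2) in \<open>auto simp: A_def\<close>)
  have alive_par: "alive (par v)" if "alive v" "v \<in> V" "v \<noteq> r" for v
  proof -
    have "(v, par v) \<in> A" unfolding A_def using that by blast
    then show ?thesis using that(1) unfolding alive_def by (meson rtrancl.rtrancl_into_rtrancl)
  qed
  have alive_root: "r \<in> L" if "alive v" for v using that L(5) unfolding alive_def by blast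
  have A_step: "(par v, w) \<in> A\<^sup>*" if "(v, w) \<in> A\<^sup>*" "v \<noteq> w" for v w
    using that(1)
  proof (cases rule: converse_rtranclE)
    case (step y)
    then show ?thesis unfolding A_def by auto
  qed (use that in simp)
  \<comment> \<open>\<open>top v\<close> is the highest vertex of the piece containing
    \<open>v\<close> and serves as the name of that piece.\<close>
  obtain top where top_r: "top r = r"
    and top_rec: "\<And>v. v \<in> V - {r} \<Longrightarrow> top v = (if v \<notin> D \<and> par v \<notin> D then top (par v) else v)"
    using rooted_recursion[OF T, of r "\<lambda>v p. if v \<notin> D \<and> par v \<notin> D then p else v"] by blast
  have top: "(v, top v) \<in> B\<^sup>* \<and> (r \<in> D \<longrightarrow> v \<notin> D \<longrightarrow> top v \<notin> D \<and> top v \<noteq> r \<and> par (top v) \<in> D)" if "v \<in> V" for v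
    using T that
  proof (induction rule: rooted_induct)
    case root
    then show ?case using top_r by simp
  next
    case (step v)
    show ?case
    proof (cases "v \<notin> D \<and> par v \<notin> D")
      case True
      then have "(v, par v) \<in> B" unfolding B_def using step by blast
      then show ?thesis using step True top_rec[of v] by (auto intro: converse_rtrancl_into_rtrancl)
    next
      case False
      then show ?thesis using step top_rec[of v] by auto
    qed
  qed
  \<comment> \<open>The lower ends of the boundary arcs that leave the piece \<open>s\<close>
    downwards towards elements of \<open>L\<close>.\<close>
  define X where "X s = {d \<in> V. d \<in> D \<and> alive d \<and> d \<noteq> r \<and> par d \<notin> D \<and> top (par d) = s}" for s
  obtain b3 where b3: "\<And>v i. v \<in> V \<Longrightarrow> v \<noteq> r \<Longrightarrow> v \<notin> D \<Longrightarrow> par v \<in> D \<Longrightarrow> i \<le> k \<Longrightarrow> i \<noteq> b3 v \<Longrightarrow>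
      (t v i, a (par v)) \<in> E" using ND by metis
  obtain b4 where b4: "\<And>v i. v \<in> V \<Longrightarrow> v \<noteq> r \<Longrightarrow> v \<in> D \<Longrightarrow> par v \<notin> D \<Longrightarrow> i \<le> k \<Longrightarrow> i \<noteq> b4 v \<Longrightarrow>
      (a v, t (par v) i) \<in> E" using DN by metis
  have beyond: "(s, d) \<in> A\<^sup>*" if "(v, s) \<in> B\<^sup>*" "(v, d) \<in> A\<^sup>*" "d \<in> D" for v s d
    using that
  proof (induction rule: converse_rtrancl_induct)
    case (step y z)
    then have "y \<notin> D" "z = par y" unfolding B_def by auto
    then show ?case using A_step[of y d] step by auto
  qed simp
  \<comment> \<open>Two members of \<open>X s\<close> are never above one another, so choosing an
    element of \<open>L\<close> below each is injective; the root is never chosen.\<close>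
  have X_card: "finite (X s) \<and> card (X s) \<le> card (L - {r})" for s
  proof -
    define below where "below v = (SOME l. l \<in> L \<and> (l, v) \<in> A\<^sup>*)" for v
    have below: "below v \<in> L \<and> (below v, v) \<in> A\<^sup>*" if "alive v" for v
      using that unfolding alive_def below_def by (intro someI_ex[of "\<lambda>l. l \<in> L \<and> (l, v) \<in> A\<^sup>*"]) blast
    have no_chain: False if "d \<in> X s" "d' \<in> X s" "(d, d') \<in> A\<^sup>*" "d \<noteq> d'" for d d'
    proof -
      have d: "par d \<in> V" "(par d, s) \<in> B\<^sup>*" and d': "d' \<in> D" "d' \<in> V" "d' \<noteq> r" "(par d', s) \<in> B\<^sup>*"
        using that top[of "par d"] top[of "par d'"] TD(2) unfolding X_def by auto
      have "(s, d') \<in> A\<^sup>*" using beyond[OF d(2) A_step[OF that(3,4)] d'(1)] .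
      then have "dep d' \<le> dep s" by (rule dep_A)
      moreover have "dep s \<le> dep (par d')" using dep_A BA d'(4) by blast
      ultimately show False using TD(3)[OF d'(2,3)] by simp
    qed
    have inj: "inj_on below (X s)"
    proof (rule inj_onI, rule ccontr)
      fix d d' assume d: "d \<in> X s" "d' \<in> X s" "below d = below d'" "d \<noteq> d'"
      have "alive d" "alive d'" using d(1,2) unfolding X_def by auto
      then have "(below d, d) \<in> A\<^sup>*" "(below d, d') \<in> A\<^sup>*"
        using below[of d] below[of d'] d(3) by auto
      then have "(d, d') \<in> A\<^sup>* \<or> (d', d) \<in> A\<^sup>*" using single_valued_confluent[OF svA] by blast
      then show False using no_chain d by metis
    qed
    have "below ` X s \<subseteq> L - {r}"
    proof
      fix l assume "l \<in> below ` X s"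
      then obtain d where d: "d \<in> X s" "l = below d" by blast
      then have "(l, d) \<in> A\<^sup>*" "l \<in> L" "d \<noteq> r" using below unfolding X_def by auto
      moreover have "w = r" if "(r, w) \<in> A\<^sup>*" for w
        using that by (cases rule: converse_rtranclE) (auto simp: A_def)
      ultimately show "l \<in> L - {r}" by blast
    qed
    then show ?thesis using inj L(1) by (meson card_inj_on_le finite_Diff inj_on_finite)
  qed
  \<comment> \<open>With the root in \<open>L\<close>, fewer than \<open>k\<close> coordinates are
    spoiled from below and at most one from above, which leaves one of the
    \<open>k + 1\<close>.\<close>
  have "\<exists>i\<le>k. i \<noteq> b3 s \<and> i \<notin> b4 ` X s" if "r \<in> L" for s
  proof -
    have "card (L - {r}) < k" using L(1,2) that by (meson card_Diff1_less le_trans less_le_trans)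
    then have "card (b4 ` X s) < k" using X_card card_image_le by (meson le_less_trans)
    moreover have fin: "finite (b4 ` X s)" using X_card by blast
    ultimately have "card (insert (b3 s) (b4 ` X s)) < card {..k}" by (simp add: card_insert_if)
    then have "\<not> {..k} \<subseteq> insert (b3 s) (b4 ` X s)"
      using fin by (meson card_mono finite_insert not_le)
    then show ?thesis by blast
  qed
  then obtain idx where idx: "\<And>s. r \<in> L \<Longrightarrow> idx s \<le> k \<and> idx s \<noteq> b3 s \<and> idx s \<notin> b4 ` X s" by metis
  \<comment> \<open>If \<open>L\<close> is empty, nothing is alive and the whole tree is folded onto
    neighbours starting from \<open>h\<close>.\<close>
  obtain g where g_r: "g r = (if L = {} then h else a r)"
    and g_rec: "\<And>v. v \<in> V - {r} \<Longrightarrow> g v = (if alive v then if v \<in> D then a v else t v (idx (top v)) else nb (g (par v)))"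
    using rooted_recursion[OF T, of "if L = {} then h else a r"
      "\<lambda>v p. if alive v then if v \<in> D then a v else t v (idx (top v)) else nb p"] by blast
  have g_alive: "g v = (if v \<in> D then a v else t v (idx (top v)))" if "alive v" "v \<in> V" for v
    using g_rec[of v] g_r alive_root[OF that(1)] L(3) that by (cases "v = r") auto
  have gV: "g v \<in> VH" if "v \<in> V" for v
    using T that
  proof (induction rule: rooted_induct)
    case root
    then show ?case using g_r VH(1,2) L(3,5) TD(1) by auto
  next
    case (step v)
    then show ?case using g_rec[of v] VH(2,3) idx alive_root[of v] nb[of "g (par v)"] TD(1) by (auto split: if_splits)
  qed
  have "(g v, g (par v)) \<in> E" if v: "v \<in> V" "v \<noteq> r" for v
  proof (cases "alive v")
    case False
    have "V \<noteq> {r}" using v by blast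
    then show ?thesis using g_rec[of v] v False nb gV[OF TD(2)[OF v]] by simp
  next
    case True
    have i: "\<And>s. idx s \<le> k \<and> idx s \<noteq> b3 s \<and> idx s \<notin> b4 ` X s" using idx alive_root[OF True] by blast
    note gs = g_alive[OF True v(1)] g_alive[OF alive_par[OF True v] TD(2)[OF v]]
    consider "v \<in> D" "par v \<in> D" | "v \<notin> D" "par v \<notin> D" | "v \<notin> D" "par v \<in> D" | "v \<in> D" "par v \<notin> D" by blast
    then show ?thesis
    proof cases
      case 1
      then show ?thesis using gs DD[OF v] by simp
    next
      case 2
      then show ?thesis using gs NN[OF v] top_rec[of v] v i by simp
    next
      case 3
      then show ?thesis using gs b3[OF v] top_rec[of v] v i by simp
    next
      case 4
      then have "v \<in> X (top (par v))" unfolding X_def using v True by simp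
      then have "idx (top (par v)) \<noteq> b4 v" using i by blast
      then show ?thesis using gs b4[OF v] 4 i by simp
    qed
  qed
  moreover have "g v = a v" if "v \<in> L" for v
  proof -
    have "alive v" unfolding alive_def using that by blast
    moreover have "v \<in> V" "v \<in> D" using that L(3,4) by auto
    ultimately show ?thesis using g_alive by simp
  qed
  ultimately show ?thesis using gV by blast
qed

subsection \<open>The glued power\<close>

definition near_unanimous :: "nat \<Rightarrow> 'a list \<Rightarrow> 'a \<Rightarrow> bool" where
  "near_unanimous k xs c \<longleftrightarrow> (\<exists>i\<le>k. \<forall>j\<le>k. j \<noteq> i \<longrightarrow> xs ! j = c)"

lemma third_index: "2 \<le> k \<Longrightarrow> \<exists>l\<le>k. l \<noteq> i \<and> l \<noteq> (j :: nat)"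
  by (cases "i = 0 \<or> j = 0"; cases "i = 1 \<or> j = 1") (auto intro: exI[of _ 0] exI[of _ 1] exI[of _ 2])

lemma near_unanimous_unique:
  "2 \<le> k \<Longrightarrow> near_unanimous k xs c \<Longrightarrow> near_unanimous k xs d \<Longrightarrow> c = d"
  unfolding near_unanimous_def using third_index[of k] by metis

locale glued_power =
  fixes H :: "'a::infinite pair_pre_digraph" and side :: "'a \<Rightarrow> bool" and k :: nat and enc :: "'a list \<Rightarrow> 'a"
  assumes H: "pair_sym_digraph H" and side: "(u, v) \<in> parcs H \<Longrightarrow> side u \<noteq> side v" and k: "2 \<le> k"
    and enc_outside: "\<lbrakk>length xs = k + 1; set xs \<subseteq> pverts H\<rbrakk> \<Longrightarrow> enc xs \<notin> pverts H"
    and enc_inj: "inj_on enc {xs. length xs = k + 1 \<and> set xs \<subseteq> pverts H}"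
begin

sublocale pair_sym_digraph H by (rule H)

definition pure :: "'a list \<Rightarrow> bool" where
  "pure xs \<longleftrightarrow> length xs = k + 1 \<and> set xs \<subseteq> pverts H \<and> (\<forall>i\<le>k. side (xs ! i) = side (xs ! 0))"

definition adj :: "'a list \<Rightarrow> 'a list \<Rightarrow> bool" where
  "adj xs ys \<longleftrightarrow> (\<forall>i\<le>k. (xs ! i, ys ! i) \<in> parcs H)"

definition glue :: "'a list \<Rightarrow> 'a" where
  "glue xs = (if \<exists>c. near_unanimous k xs c then THE c. near_unanimous k xs c else enc xs)"

text \<open>A quotient of the part of the power on one-sided tuples. The arcs of \<open>H\<close>
  itself arise from constant tuples.\<close>

definition glued :: "'a pair_pre_digraph" where
  "glued = \<lparr> pverts = pverts H \<union> glue ` {xs. pure xs},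
     parcs = {(glue xs, glue ys) |xs ys. pure xs \<and> pure ys \<and> adj xs ys} \<rparr>"

lemma glue_nu: "near_unanimous k xs c \<Longrightarrow> glue xs = c"
  unfolding glue_def using near_unanimous_unique[OF k] by (metis the_equality)

lemma pure_side: "pure xs \<Longrightarrow> i \<le> k \<Longrightarrow> side (xs ! i) = side (xs ! 0)"
  unfolding pure_def by blast

lemma pure_nth: "pure xs \<Longrightarrow> i \<le> k \<Longrightarrow> xs ! i \<in> pverts H"
  unfolding pure_def by (metis Suc_eq_plus1 le_imp_less_Suc nth_mem subsetD)

lemma pure_nu_side:
  assumes "pure xs" "near_unanimous k xs c"
  shows "c \<in> pverts H" "side c = side (xs ! 0)"
proof -
  obtain i where "i \<le> k" "\<And>j. j \<le> k \<Longrightarrow> j \<noteq> i \<Longrightarrow> xs ! j = c"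
    using assms(2) unfolding near_unanimous_def by blast
  moreover obtain j where "j \<le> k" "j \<noteq> i" using third_index[OF k, of i i] by blast
  ultimately have "j \<le> k" "xs ! j = c" by auto
  then show "c \<in> pverts H" "side c = side (xs ! 0)"
    using pure_nth[OF assms(1), of j] pure_side[OF assms(1), of j] by auto
qed

lemma glue_cases:
  assumes "pure xs"
  shows "near_unanimous k xs (glue xs) \<and> glue xs \<in> pverts H \<or> glue xs = enc xs \<and> glue xs \<notin> pverts H"
proof (cases "\<exists>c. near_unanimous k xs c")
  case True
  then obtain c where c: "near_unanimous k xs c" by blast
  then show ?thesis using glue_nu[OF c] pure_nu_side[OF assms c] by simp
next
  case False
  then have "glue xs = enc xs" unfolding glue_def by (rule if_not_P)
  then show ?thesis using enc_outside[of xs] assms unfolding pure_def by metis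
qed

lemma adj_sym: "adj xs ys \<Longrightarrow> adj ys xs"
  unfolding adj_def using arcs_symmetric by blast

text \<open>Outside \<open>H\<close> this inverts \<open>glue\<close>. At a vertex of
  \<open>H\<close> it is one of several preimages, all on the side of that vertex.\<close>

definition tuple :: "'a \<Rightarrow> 'a list" where
  "tuple g = (SOME xs. pure xs \<and> glue xs = g)"

lemma tuple: "pure xs \<Longrightarrow> pure (tuple (glue xs)) \<and> glue (tuple (glue xs)) = glue xs"
  unfolding tuple_def by (rule someI_ex) blast

lemma tuple_glue:
  assumes "pure xs" "glue xs \<notin> pverts H"
  shows "tuple (glue xs) = xs"
proof -
  let ?t = "tuple (glue xs)"
  have t: "pure ?t" "glue ?t = glue xs" using tuple[OF assms(1)] by blast+
  have "enc ?t = enc xs" using glue_cases[OF assms(1)] glue_cases[OF t(1)] t(2) assms(2) by simp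
  then show ?thesis
    by (rule inj_onD[OF enc_inj]) (use t(1) assms(1) in \<open>simp_all add: pure_def\<close>)
qed

lemma const_pure:
  assumes "x \<in> pverts H"
  shows "pure (replicate (k + 1) x)" "glue (replicate (k + 1) x) = x"
proof -
  have nth: "replicate (k + 1) x ! i = x" if "i \<le> k" for i using that by (simp del: replicate_Suc)
  then show "pure (replicate (k + 1) x)" unfolding pure_def using assms by (auto simp del: replicate_Suc)
  have "near_unanimous k (replicate (k + 1) x) x" unfolding near_unanimous_def using nth by blast
  then show "glue (replicate (k + 1) x) = x" by (rule glue_nu)
qed

text \<open>At most two of the at least three coordinates are exceptional, and any other coordinate
  carries the arc. Hence gluing adds no arc inside \<open>H\<close>.\<close>

lemma arc_HH:
  assumes "(u, v) \<in> parcs glued" "u \<in> pverts H" "v \<in> pverts H"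
  shows "(u, v) \<in> parcs H"
proof -
  obtain xs ys where xy: "pure xs" "pure ys" "adj xs ys" "u = glue xs" "v = glue ys"
    using assms(1) unfolding glued_def by auto
  then have "near_unanimous k xs u" "near_unanimous k ys v" using glue_cases assms(2,3) by metis+
  then obtain i j where "\<And>l. l \<le> k \<Longrightarrow> l \<noteq> i \<Longrightarrow> xs ! l = u" "\<And>l. l \<le> k \<Longrightarrow> l \<noteq> j \<Longrightarrow> ys ! l = v"
    unfolding near_unanimous_def by blast
  moreover obtain l where "l \<le> k" "l \<noteq> i" "l \<noteq> j" using third_index[OF k] by blast
  ultimately show ?thesis using xy(3) unfolding adj_def by metis
qed

lemma arc_NN:
  assumes "(u, v) \<in> parcs glued" "u \<notin> pverts H" "v \<notin> pverts H" "i \<le> k"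
  shows "(tuple u ! i, tuple v ! i) \<in> parcs H"
  using assms tuple_glue unfolding glued_def adj_def by auto

lemma arc_NH:
  assumes "(u, v) \<in> parcs glued" "u \<notin> pverts H" "v \<in> pverts H"
  shows "\<exists>i0. \<forall>i\<le>k. i \<noteq> i0 \<longrightarrow> (tuple u ! i, v) \<in> parcs H"
proof -
  obtain xs ys where xy: "pure xs" "pure ys" "adj xs ys" "u = glue xs" "v = glue ys"
    using assms(1) unfolding glued_def by auto
  then have "near_unanimous k ys v" "tuple u = xs" using glue_cases assms(2,3) tuple_glue by metis+
  then show ?thesis using xy(3) unfolding near_unanimous_def adj_def by metis
qed

lemma arc_sym: "(u, v) \<in> parcs glued \<Longrightarrow> (v, u) \<in> parcs glued"
  unfolding glued_def using adj_sym by auto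

lemma arc_HN:
  assumes "(u, v) \<in> parcs glued" "u \<in> pverts H" "v \<notin> pverts H"
  shows "\<exists>i0. \<forall>i\<le>k. i \<noteq> i0 \<longrightarrow> (u, tuple v ! i) \<in> parcs H"
proof -
  obtain i0 where "\<And>i. i \<le> k \<Longrightarrow> i \<noteq> i0 \<Longrightarrow> (tuple v ! i, u) \<in> parcs H"
    using arc_NH[OF arc_sym[OF assms(1)] assms(3,2)] by blast
  from this[THEN arcs_symmetric] show ?thesis by blast
qed

lemma glued_sym: "pair_sym_digraph glued"
proof unfold_locales
  show "fst e \<in> pverts glued" "snd e \<in> pverts glued" if "e \<in> parcs glued" for e
    using that unfolding glued_def by auto
  show "symmetric (with_proj glued)" unfolding symmetric_def using arc_sym by (auto simp: sym_def)
qed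

lemma H_arcs: "parcs H = {e \<in> parcs glued. fst e \<in> pverts H \<and> snd e \<in> pverts H}"
proof -
  have sub: "(u, v) \<in> parcs glued" if uv: "(u, v) \<in> parcs H" for u v
  proof -
    have "u \<in> pverts H" "v \<in> pverts H" using uv in_arcsD1 in_arcsD2 by blast+
    note c = const_pure[OF this(1)] const_pure[OF this(2)]
    have "adj (replicate (k + 1) u) (replicate (k + 1) v)"
      unfolding adj_def using uv by (simp del: replicate_Suc)
    then have "(glue (replicate (k + 1) u), glue (replicate (k + 1) v)) \<in> parcs glued"
      unfolding glued_def pair_pre_digraph.simps using c(1,3) by blast
    then show ?thesis unfolding c(2,4) .
  qed
  show ?thesis
  proof (intro set_eqI iffI)
    fix e assume "e \<in> parcs H"
    then show "e \<in> {e \<in> parcs glued. fst e \<in> pverts H \<and> snd e \<in> pverts H}"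
      using sub[of "fst e" "snd e"] arc_fst_in_verts[of e] arc_snd_in_verts[of e] by simp
  next
    fix e assume "e \<in> {e \<in> parcs glued. fst e \<in> pverts H \<and> snd e \<in> pverts H}"
    then show "e \<in> parcs H" using arc_HH[of "fst e" "snd e"] by simp
  qed
qed

text \<open>A one-sided tuple glued to a vertex of \<open>H\<close> lies on the side of that vertex,
  so the side of coordinate 0 does not depend on the chosen preimage.\<close>

lemma glued_bipartite: "bipartite_graph glued"
proof -
  define s where "s g = side (tuple g ! 0)" for g
  have s: "s (glue xs) = side (xs ! 0)" if xs: "pure xs" for xs
  proof (cases "glue xs \<in> pverts H")
    case True
    then have "near_unanimous k xs (glue xs)" "near_unanimous k (tuple (glue xs)) (glue xs)"
      using glue_cases[OF xs] glue_cases[of "tuple (glue xs)"] tuple[OF xs] by auto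
    then show ?thesis unfolding s_def using pure_nu_side(2) xs tuple[OF xs] by metis
  next
    case False
    then show ?thesis unfolding s_def using tuple_glue[OF xs] by simp
  qed
  have flip: "s u \<noteq> s v" if "(u, v) \<in> parcs glued" for u v
    using that s side unfolding glued_def adj_def by auto
  interpret glued: pair_sym_digraph glued by (rule glued_sym)
  have "parcs glued \<subseteq> {v \<in> pverts glued. s v} \<times> {v \<in> pverts glued. \<not> s v} \<union>
      {v \<in> pverts glued. \<not> s v} \<times> {v \<in> pverts glued. s v}"
  proof
    fix e assume "e \<in> parcs glued"
    then show "e \<in> {v \<in> pverts glued. s v} \<times> {v \<in> pverts glued. \<not> s v} \<union>
      {v \<in> pverts glued. \<not> s v} \<times> {v \<in> pverts glued. s v}"
      using flip[of "fst e" "snd e"] glued.arc_fst_in_verts[of e] glued.arc_snd_in_verts[of e]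
      by (cases e) simp
  qed
  then show ?thesis unfolding bipartite_graph_def using glued_sym
    by (intro conjI exI[of _ "{v \<in> pverts glued. s v}"] exI[of _ "{v \<in> pverts glued. \<not> s v}"]) blast+
qed

lemma glued_induced: "induced_subgraph (with_proj H) (with_proj glued)"
  unfolding induced_subgraph_def subgraph_def with_proj_simps wf_digraph_wp_iff
proof (intro conjI)
  show "pverts H \<subseteq> pverts glued" unfolding glued_def by simp
  show "parcs H \<subseteq> parcs glued" using H_arcs by blast
  show "pair_wf_digraph glued" "pair_wf_digraph H"
    using glued_sym H by (simp_all add: pair_sym_digraph_def)
qed (use H_arcs compatibleI_with_proj in blast)+

text \<open>Here \<open>tree_projection\<close> is applied with \<open>D\<close> the vertices sent
  into \<open>H\<close>. It shows that an obstruction for \<open>H\<close> with at most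
  \<open>k\<close> leaves is one for \<open>glued\<close> too.\<close>

lemma tree_into_power:
  fixes T :: "('v, 'a) coloured_graph"
  assumes T: "H_tree H T" "finite (leaves (underlying T))" "card (leaves (underlying T)) \<le> k"
    and F: "coloured_hom H T (self_coloured H glued) F" and conn: "Digraph_Component.connected (with_proj H)"
  shows "\<exists>g. coloured_hom H T (self_coloured H H) g"
proof -
  let ?T = "underlying T" and ?V = "pverts (underlying T)"
  let ?L = "leaves (underlying T)"
  have tree: "undirected_tree ?T" and cols: "(\<Union>h\<in>pverts H. colour T h) = ?L"
    using T(1) unfolding H_tree_def by blast+
  have "pair_sym_digraph ?T" "Digraph_Component.connected (with_proj ?T)"
    using tree unfolding undirected_tree_def pair_bidirected_digraph_def by blast+
  from connected_rtrancl(1)[OF this] have "?V \<noteq> {}" .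
  moreover have LV: "?L \<subseteq> ?V" unfolding leaves_def by blast
  \<comment> \<open>The root is taken to be a leaf if there is one: this leaves at most
    \<open>k - 1\<close> leaves below any piece.\<close>
  ultimately obtain r where r: "r \<in> ?V" "?L \<noteq> {} \<Longrightarrow> r \<in> ?L" by blast
  obtain par dep where root: "rooted ?V r par dep" and T_eq: "?T = parent_graph ?V r par"
    using undirected_tree_rooted[OF tree r(1)] by blast
  have FV: "F v \<in> pverts glued" if "v \<in> ?V" for v
    using F that unfolding coloured_hom_def graph_hom_def self_coloured_def by simp
  have F_arc: "(F u, F v) \<in> parcs glued" if "(u, v) \<in> parcs ?T" for u v
    using F that unfolding coloured_hom_def graph_hom_def self_coloured_def by auto
  have par_arc: "(v, par v) \<in> parcs ?T" if "v \<in> ?V" "v \<noteq> r" for v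
    using that rootedD(2)[OF root] by (subst T_eq) (simp add: parent_graph_def)
  note e = F_arc[OF par_arc]
  have F_col: "F v = h" if "h \<in> pverts H" "v \<in> colour T h" for v h
    using F that unfolding coloured_hom_def self_coloured_def by auto
  obtain h0 where h0: "h0 \<in> pverts H" using connected_rtrancl(1)[OF H conn] by blast
  have nbr: "\<exists>c. c \<in> pverts H \<and> (c, b) \<in> parcs H" if ne: "?V \<noteq> {r}" and b: "b \<in> pverts H" for b
  proof -
    obtain v where "v \<in> ?V" "v \<noteq> r" using ne r(1) by blast
    from e[OF this] have "\<exists>xs ys. adj xs ys" unfolding glued_def by auto
    then obtain x y where xy: "(x, y) \<in> parcs H" unfolding adj_def by blast
    have "(b, x) \<in> (parcs H)\<^sup>*" by (rule connected_rtrancl(2)[OF H conn b in_arcsD1[OF xy]])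
    then obtain c where "(b, c) \<in> parcs H" using xy by (cases rule: converse_rtranclE) auto
    then show ?thesis using arcs_symmetric[of b c] in_arcsD2[of b c] by auto
  qed
  define nb where "nb b = (SOME c. c \<in> pverts H \<and> (c, b) \<in> parcs H)" for b
  have nb: "nb b \<in> pverts H \<and> (nb b, b) \<in> parcs H" if "?V \<noteq> {r}" "b \<in> pverts H" for b
    unfolding nb_def using nbr[OF that] by (rule someI_ex)
  have N_pure: "pure (tuple (F v))" if "v \<in> ?V" "F v \<notin> pverts H" for v
    using FV[OF that(1)] that(2) tuple unfolding glued_def by auto
  have "\<exists>g. (\<forall>v\<in>?V. g v \<in> pverts H) \<and> (\<forall>v\<in>?V - {r}. (g v, g (par v)) \<in> parcs H) \<and> (\<forall>v\<in>?L. g v = F v)"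
  proof (rule tree_projection[where nb = nb and h = h0, OF root T(2,3) _ LV r(2)])
    show "?L \<subseteq> {v. F v \<in> pverts H}" using cols F_col by force
    show "(F v, F (par v)) \<in> parcs H"
      if "v \<in> ?V" "v \<noteq> r" "v \<in> {v. F v \<in> pverts H}" "par v \<in> {v. F v \<in> pverts H}" for v
      using arc_HH[OF e[OF that(1,2)]] that by simp
    show "(tuple (F v) ! i, tuple (F (par v)) ! i) \<in> parcs H"
      if "v \<in> ?V" "v \<noteq> r" "v \<notin> {v. F v \<in> pverts H}" "par v \<notin> {v. F v \<in> pverts H}" "i \<le> k" for v i
      using arc_NN[OF e[OF that(1,2)]] that by simp
    show "\<exists>i0. \<forall>i\<le>k. i \<noteq> i0 \<longrightarrow> (tuple (F v) ! i, F (par v)) \<in> parcs H"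
      if "v \<in> ?V" "v \<noteq> r" "v \<notin> {v. F v \<in> pverts H}" "par v \<in> {v. F v \<in> pverts H}" for v
      using arc_NH[OF e[OF that(1,2)]] that by simp
    show "\<exists>i0. \<forall>i\<le>k. i \<noteq> i0 \<longrightarrow> (F v, tuple (F (par v)) ! i) \<in> parcs H"
      if "v \<in> ?V" "v \<noteq> r" "v \<in> {v. F v \<in> pverts H}" "par v \<notin> {v. F v \<in> pverts H}" for v
      using arc_HN[OF e[OF that(1,2)]] that by simp
    show "tuple (F v) ! i \<in> pverts H" if "v \<in> ?V" "v \<notin> {v. F v \<in> pverts H}" "i \<le> k" for v i
      using pure_nth[OF N_pure] that by simp
    show "nb b \<in> pverts H \<and> (nb b, b) \<in> parcs H" if "?V \<noteq> {r}" "b \<in> pverts H" for b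
      by (rule nb[OF that])
  qed (use h0 in auto)
  then obtain g where g: "\<And>v. v \<in> ?V \<Longrightarrow> g v \<in> pverts H"
    "\<And>v. v \<in> ?V \<Longrightarrow> v \<noteq> r \<Longrightarrow> (g v, g (par v)) \<in> parcs H" "\<And>v. v \<in> ?L \<Longrightarrow> g v = F v" by blast
  have "(g u, g v) \<in> parcs H" if "(u, v) \<in> parcs ?T" for u v
  proof -
    have "(u, v) \<in> parcs (parent_graph ?V r par)" using that T_eq by simp
    then have "u \<in> ?V \<and> u \<noteq> r \<and> par u = v \<or> v \<in> ?V \<and> v \<noteq> r \<and> par v = u"
      unfolding parent_graph_def by auto
    then show ?thesis using g(2)[of u] g(2)[of v] arcs_symmetric[of "g v" "g u"] by auto
  qed
  then have "graph_hom ?T H g" unfolding graph_hom_def using g(1) by blast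
  moreover have "g v = h" if "h \<in> pverts H" "v \<in> colour T h" for v h
    using F_col[OF that] g(3)[of v] cols that by blast
  ultimately have "coloured_hom H T (self_coloured H H) g"
    unfolding coloured_hom_def self_coloured_def by auto
  then show ?thesis by blast
qed

text \<open>
  On tuples meeting both sides of \<open>H\<close> a projection does: near-unanimity is only at stake if all but
  one of the coordinates lie on the same side, and then the projection avoids the exceptional one.
\<close>

lemma nu_of_retract:
  assumes "is_retract H glued"
  shows "\<exists>f. nu_polymorphism H (k + 1) f"
proof -
  obtain r where r: "graph_hom glued H r" "\<And>h. h \<in> pverts H \<Longrightarrow> r h = h"
    using assms unfolding is_retract_def by blast
  define minority0 where "minority0 xs \<longleftrightarrow> (\<forall>j\<le>k. j \<noteq> 0 \<longrightarrow> side (xs ! j) \<noteq> side (xs ! 0))" for xs :: "'a list"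
  define f where "f xs = (if pure xs then r (glue xs) else xs ! (if minority0 xs then 1 else 0))" for xs
  have one: "1 \<le> k" using k by simp
  have "f xs \<in> pverts H" if "length xs = k + 1" "set xs \<subseteq> pverts H" for xs
  proof (cases "pure xs")
    case True
    then show ?thesis using r(1) unfolding f_def graph_hom_def glued_def by simp
  next
    case False
    then show ?thesis using that one unfolding f_def by (auto simp: subset_iff)
  qed
  moreover have "(f xs, f ys) \<in> parcs H"
    if xy: "length xs = k + 1" "set xs \<subseteq> pverts H" "length ys = k + 1" "set ys \<subseteq> pverts H" "adj xs ys" for xs ys
  proof -
    have s: "side (ys ! i) = (\<not> side (xs ! i))" if "i \<le> k" for i
      using xy(5) side that unfolding adj_def by auto
    have "(\<forall>i\<le>k. side (xs ! i) = side (xs ! 0)) \<longleftrightarrow> (\<forall>i\<le>k. side (ys ! i) = side (ys ! 0))"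
      using s by (metis le0)
    \<comment> \<open>Adjacency flips the side of every coordinate, so the same rule for
      \<open>f\<close> applies to both tuples.\<close>
    then have "pure xs = pure ys" unfolding pure_def using xy(1-4) by simp
    moreover have "minority0 xs = minority0 ys" unfolding minority0_def using s by (metis le0)
    moreover have "(glue xs, glue ys) \<in> parcs glued" if "pure xs" "pure ys"
      using that xy(5) unfolding glued_def by auto
    ultimately show ?thesis
      using r(1) xy(5) one unfolding f_def graph_hom_def adj_def by auto
  qed
  ultimately have hom: "graph_hom (graph_power H (k + 1)) H f"
    unfolding graph_hom_def graph_power_def adj_def by (auto simp: Let_def less_Suc_eq_le)
  have nu: "f xs = x"
    if x: "x \<in> pverts H" "length xs = k + 1" "set xs \<subseteq> pverts H" and i: "i \<le> k"
      "\<And>j. j \<le> k \<Longrightarrow> j \<noteq> i \<Longrightarrow> xs ! j = x" for xs x i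
  proof (cases "pure xs")
    case True
    have "near_unanimous k xs x" using i unfolding near_unanimous_def by blast
    then show ?thesis using glue_nu r(2) x True unfolding f_def by simp
  next
    case False
    \<comment> \<open>Since the tuple is not one-sided, its exceptional coordinate lies opposite to
      all others, and \<open>minority0\<close> detects whether it is coordinate 0.\<close>
    have "side (xs ! i) \<noteq> side x"
    proof
      assume "side (xs ! i) = side x"
      then have "side (xs ! j) = side x" if "j \<le> k" for j using i(2)[OF that] by (cases "j = i") auto
      then have "pure xs" unfolding pure_def using x by simp
      then show False using False by simp
    qed
    then have "minority0 xs \<longleftrightarrow> i = 0"
    proof (cases "i = 0")
      case True
      then show ?thesis using i \<open>side (xs ! i) \<noteq> side x\<close> unfolding minority0_def by auto
    next
      case False
      obtain l where "l \<le> k" "l \<noteq> 0" "l \<noteq> i" using third_index[OF k] by blast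
      then show ?thesis using i(2)[of l] i(2)[of 0] False unfolding minority0_def by auto
    qed
    then show ?thesis using i(2)[of 1] i(2)[of 0] one False unfolding f_def by auto
  qed
  have "f (replicate (k + 1) x) = x" if "x \<in> pverts H" for x
    by (rule nu[of x _ 0]) (use that in \<open>auto simp del: replicate_Suc\<close>)
  moreover have "f ((replicate (k + 1) x)[i := y]) = x" if "x \<in> pverts H" "y \<in> pverts H" "i < k + 1" for x y i
  proof (rule nu[of x _ i])
    show "set ((replicate (k + 1) x)[i := y]) \<subseteq> pverts H"
      using that set_update_subset_insert[of "replicate (k + 1) x" i y] by (auto simp del: replicate_Suc)
  qed (use that in \<open>auto simp del: replicate_Suc\<close>)
  ultimately show ?thesis using hom unfolding nu_polymorphism_def by blast
qed

end

section \<open>The two directions of the equivalence\<close>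

lemma nu_if_absolute_retract:
  fixes H :: "'a::infinite pair_pre_digraph"
  assumes bip: "bipartite_graph H" and conn: "Digraph_Component.connected (with_proj H)"
    and fin_H: "finite (pverts H)" and k: "2 \<le> k" and AR: "bipartite_absolute_retract k H" and side: "\<And>u v. (u, v) \<in> parcs H \<Longrightarrow> side u \<noteq> (side v :: bool)"
  shows "\<exists>f. nu_polymorphism H (k + 1) f"
proof -
  let ?S = "{xs. length xs = k + 1 \<and> set xs \<subseteq> pverts H}"
  have fin: "finite ?S" using finite_lists_length_eq[OF fin_H, of "k + 1"] by (simp add: conj_commute)
  \<comment> \<open>The universe is infinite and \<open>H\<close> finite, so all tuples can be named
    by vertices outside \<open>H\<close>.\<close>
  have "infinite (UNIV - pverts H)" using fin_H by (simp add: infinite_UNIV)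
  from infinite_arbitrarily_large[OF this, of "card ?S"] obtain C
    where C: "finite C" "card C = card ?S" "C \<subseteq> UNIV - pverts H" by blast
  obtain enc where "bij_betw enc ?S C" using finite_same_card_bij[OF fin C(1) C(2)[symmetric]] by blast
  then have enc: "inj_on enc ?S" "enc ` ?S \<subseteq> UNIV - pverts H" using C(3) unfolding bij_betw_def by auto
  interpret glued_power H side k enc
  proof (rule glued_power.intro)
    show "pair_sym_digraph H" using bip unfolding bipartite_graph_def by blast
    show "enc xs \<notin> pverts H" if "length xs = k + 1" "set xs \<subseteq> pverts H" for xs using enc(2) that by blast
  qed (use k enc(1) side in blast)+
  have "is_retract H glued"
    using AR glued_bipartite glued_induced tree_into_power[OF _ _ _ _ conn]
    unfolding bipartite_absolute_retract_def obstruction_def by blast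
  then show ?thesis by (rule nu_of_retract)
qed

theorem theorem1:
  fixes H :: "'a::infinite pair_pre_digraph" and k :: nat
  assumes "bipartite_graph H"
    and "Digraph_Component.connected (with_proj H)"
    and "finite (pverts H)"
    and "2 \<le> k"
  shows "bipartite_absolute_retract k H \<longleftrightarrow> (\<exists>f. nu_polymorphism H (k + 1) f)"
proof
  obtain side :: "'a \<Rightarrow> bool" where "\<And>u v. (u, v) \<in> parcs H \<Longrightarrow> side u \<noteq> side v"
    using bipartite_side[OF assms(1)] by blast
  then show "\<exists>f. nu_polymorphism H (k + 1) f" if "bipartite_absolute_retract k H"
    using nu_if_absolute_retract[OF assms that] by blast
next
  assume "\<exists>f. nu_polymorphism H (k + 1) f"
  then obtain m where m: "nu_polymorphism H (k + 1) m" by blast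
  have H: "pair_sym_digraph H" using assms(1) unfolding bipartite_graph_def by blast
  show "bipartite_absolute_retract k H"
    unfolding bipartite_absolute_retract_def
  proof (intro allI impI, elim conjE)
    fix G :: "'a pair_pre_digraph"
    assume G: "bipartite_graph G" "induced_subgraph (with_proj H) (with_proj G)"
      and small: "\<forall>T :: ('a, 'a) coloured_graph.
           H_tree H T \<and> finite (leaves (underlying T)) \<and> card (leaves (underlying T)) \<le> k \<and>
           obstruction H T (self_coloured H H) \<longrightarrow> obstruction H T (self_coloured H G)"
    show "is_retract H G"
      by (rule retract_if_nu[OF _ H assms(2,3) G assms(4) m]) (use small in blast)
  qed
qed

end
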